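(* Let $d\in\mathbb N$. There is a Hilbert space $\mathcal H$, a family $\mathscr N_d$ of commuting normal contractions on $\mathcal H$, and an isometry $V:\mathbb C^d\to\mathcal H$ such that for each complex $d\times d$ contraction matrix $X$ there exists a $T\in\mathscr N_d$ such that $$\frac1{\sqrt2\,\vartheta(2d)}X=V^*TV.$$
   Context: A contraction is a matrix or operator of operator norm at most one. For a positive integer $m$, $\vartheta(m)$ is defined by $\frac1{\vartheta(m)}=\min\big\{\int_{S^{m-1}}|\xi^*B\xi|\,d\xi:\ B\text{ a real symmetric }m\times m\text{ matrix},\ \operatorname{tr}|B|=m\big\}$, where the unit sphere $S^{m-1}\subseteq\mathbb R^m$ carries the rotation invariant probability measure. *)

theory Defs
  imports
    "HOL-Probability.Probability"
    "HOL-Algebra.Module"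
begin

section \<open>Complex Hilbert spaces and their operators\<close>

text \<open>
  The distribution has no complex inner product spaces. A complex Hilbert space is modelled as a
  vector space in the sense of \<open>HOL-Algebra\<close> (a module over the field of complex numbers, given on
  an explicit carrier) together with an inner product, linear in the first argument, with respect to
  which it is complete. The ring record underlying a module also has a multiplication and a unit,
  which the locale for modules ignores. All notions below refer to arguments in the carrier only.
\<close>

definition complex_field :: "complex ring" where
  "complex_field = \<lparr>carrier = UNIV, mult = (*), one = 1, zero = 0, add = (+)\<rparr>"

lemma cring_complex_field: "cring complex_field"
proof (rule cringI)
  show "abelian_group complex_field"
  proof (rule abelian_groupI)
    fix x assume "x \<in> carrier complex_field"
    show "\<exists>y\<in>carrier complex_field. y \<oplus>\<^bsub>complex_field\<^esub> x = \<zero>\<^bsub>complex_field\<^esub>"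
      by (rule bexI[of _ "- x"]) (auto simp: complex_field_def)
  qed (auto simp: complex_field_def)
  show "Group.comm_monoid complex_field"
    by (rule Group.comm_monoidI) (auto simp: complex_field_def)
qed (auto simp: complex_field_def algebra_simps)

record 'h hilbert = "(complex, 'h) module" +
  hinner :: "'h \<Rightarrow> 'h \<Rightarrow> complex"

definition hnorm :: "('h, 'm) hilbert_scheme \<Rightarrow> 'h \<Rightarrow> real" where
  "hnorm H x = sqrt (Re (hinner H x x))"

locale complex_hilbert_space = Module.module complex_field H
  for H :: "('h, 'm) hilbert_scheme" (structure) +
  assumes hinner_add_left:
      "\<lbrakk>x \<in> carrier H; y \<in> carrier H; z \<in> carrier H\<rbrakk> \<Longrightarrow>
         hinner H (x \<oplus>\<^bsub>H\<^esub> y) z = hinner H x z + hinner H y z"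
    and hinner_smult_left:
      "\<lbrakk>x \<in> carrier H; y \<in> carrier H\<rbrakk> \<Longrightarrow>
         hinner H (c \<odot>\<^bsub>H\<^esub> x) y = c * hinner H x y"
    and hinner_commute:
      "\<lbrakk>x \<in> carrier H; y \<in> carrier H\<rbrakk> \<Longrightarrow> hinner H y x = cnj (hinner H x y)"
    and hinner_nonneg:
      "x \<in> carrier H \<Longrightarrow> 0 \<le> Re (hinner H x x)"
    and hinner_definite:
      "\<lbrakk>x \<in> carrier H; hinner H x x = 0\<rbrakk> \<Longrightarrow> x = \<zero>\<^bsub>H\<^esub>"
    and hilbert_complete:
      "\<lbrakk>\<And>n::nat. s n \<in> carrier H;
        \<And>e. 0 < e \<Longrightarrow> \<exists>M. \<forall>m\<ge>M. \<forall>n\<ge>M. hnorm H (s m \<ominus>\<^bsub>H\<^esub> s n) < e\<rbrakk> \<Longrightarrow>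
         \<exists>l\<in>carrier H. (\<lambda>n. hnorm H (s n \<ominus>\<^bsub>H\<^esub> l)) \<longlonglongrightarrow> 0"

definition linear_operator ::
    "('h, 'm) hilbert_scheme \<Rightarrow> ('k, 'n) hilbert_scheme \<Rightarrow> ('h \<Rightarrow> 'k) \<Rightarrow> bool" where
  "linear_operator H K T \<longleftrightarrow>
     T \<in> carrier H \<rightarrow> carrier K \<and>
     (\<forall>x\<in>carrier H. \<forall>y\<in>carrier H. T (x \<oplus>\<^bsub>H\<^esub> y) = T x \<oplus>\<^bsub>K\<^esub> T y) \<and>
     (\<forall>c. \<forall>x\<in>carrier H. T (c \<odot>\<^bsub>H\<^esub> x) = c \<odot>\<^bsub>K\<^esub> T x)"

definition bounded_operator ::
    "('h, 'm) hilbert_scheme \<Rightarrow> ('k, 'n) hilbert_scheme \<Rightarrow> ('h \<Rightarrow> 'k) \<Rightarrow> bool" where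
  "bounded_operator H K T \<longleftrightarrow>
     linear_operator H K T \<and> (\<exists>C. \<forall>x\<in>carrier H. hnorm K (T x) \<le> C * hnorm H x)"

text \<open>As for \<^const>\<open>onorm\<close>, the quotient at \<open>x = 0\<close> is \<open>0 / 0 = 0\<close>.\<close>

definition operator_norm ::
    "('h, 'm) hilbert_scheme \<Rightarrow> ('k, 'n) hilbert_scheme \<Rightarrow> ('h \<Rightarrow> 'k) \<Rightarrow> real" where
  "operator_norm H K T = (SUP x\<in>carrier H. hnorm K (T x) / hnorm H x)"

definition contraction ::
    "('h, 'm) hilbert_scheme \<Rightarrow> ('k, 'n) hilbert_scheme \<Rightarrow> ('h \<Rightarrow> 'k) \<Rightarrow> bool" where
  "contraction H K T \<longleftrightarrow> bounded_operator H K T \<and> operator_norm H K T \<le> 1"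

definition isometry ::
    "('h, 'm) hilbert_scheme \<Rightarrow> ('k, 'n) hilbert_scheme \<Rightarrow> ('h \<Rightarrow> 'k) \<Rightarrow> bool" where
  "isometry H K V \<longleftrightarrow> linear_operator H K V \<and> (\<forall>x\<in>carrier H. hnorm K (V x) = hnorm H x)"

text \<open>
  For a bounded operator \<open>T\<close> between Hilbert spaces and \<open>y\<close> in the codomain, the vector \<open>T\<^sup>* y\<close> exists
  uniquely by the Riesz representation theorem.
\<close>

definition adjoint_operator ::
    "('h, 'm) hilbert_scheme \<Rightarrow> ('k, 'n) hilbert_scheme \<Rightarrow> ('h \<Rightarrow> 'k) \<Rightarrow> 'k \<Rightarrow> 'h" where
  "adjoint_operator H K T y =
     (THE x. x \<in> carrier H \<and> (\<forall>z\<in>carrier H. hinner K (T z) y = hinner H z x))"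

definition normal_operator :: "('h, 'm) hilbert_scheme \<Rightarrow> ('h \<Rightarrow> 'h) \<Rightarrow> bool" where
  "normal_operator H T \<longleftrightarrow>
     bounded_operator H H T \<and>
     (\<forall>x\<in>carrier H. adjoint_operator H H T (T x) = T (adjoint_operator H H T x))"

definition commuting_operators :: "('h, 'm) hilbert_scheme \<Rightarrow> ('h \<Rightarrow> 'h) set \<Rightarrow> bool" where
  "commuting_operators H N \<longleftrightarrow> (\<forall>S\<in>N. \<forall>T\<in>N. \<forall>x\<in>carrier H. S (T x) = T (S x))"

definition complex_euclidean :: "(complex ^ 'd::finite) hilbert" where
  "complex_euclidean =
     \<lparr>carrier = UNIV, mult = (*), one = 1, zero = 0, add = (+),
      smult = (*s), hinner = (\<lambda>x y. \<Sum>i\<in>UNIV. x $ i * cnj (y $ i))\<rparr>"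

lemma hnorm_complex_euclidean: "hnorm complex_euclidean x = norm x"
proof -
  have "Re (\<Sum>i\<in>UNIV. x $ i * cnj (x $ i)) = (\<Sum>i\<in>UNIV. (norm (x $ i))\<^sup>2)"
    by (simp add: complex_norm_square[symmetric] flip: of_real_power of_real_sum)
  then show ?thesis
    by (simp add: hnorm_def complex_euclidean_def norm_vec_def L2_set_def)
qed

lemma complex_hilbert_space_complex_euclidean:
  "complex_hilbert_space (complex_euclidean :: (complex ^ 'd::finite) hilbert)"
proof -
  let ?E = "complex_euclidean :: (complex ^ 'd) hilbert"
  have "abelian_group ?E"
  proof (rule abelian_groupI)
    fix x assume "x \<in> carrier ?E"
    show "\<exists>y\<in>carrier ?E. y \<oplus>\<^bsub>?E\<^esub> x = \<zero>\<^bsub>?E\<^esub>"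
      by (rule bexI[of _ "- x"]) (auto simp: complex_euclidean_def)
  qed (auto simp: complex_euclidean_def algebra_simps)
  moreover have "cring complex_field"
    by (rule cring_complex_field)
  ultimately have mod: "Module.module complex_field ?E"
    by (intro Module.moduleI)
       (auto simp: complex_euclidean_def complex_field_def vector_add_ldistrib
          vector_sadd_rdistrib vector_smult_assoc)
  interpret E: Module.module complex_field ?E by fact
  have minus: "x \<ominus>\<^bsub>?E\<^esub> y = x - y" for x y
  proof -
    have "\<ominus>\<^bsub>?E\<^esub> y = - y"
      by (rule E.minus_equality) (auto simp: complex_euclidean_def)
    then show ?thesis
      by (simp add: a_minus_def) (simp add: complex_euclidean_def)
  qed
  show ?thesis
  proof (unfold_locales, goal_cases)
    case (5 x)
    then have "norm x = 0"
      by (simp flip: hnorm_complex_euclidean add: hnorm_def)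
    then show ?case by (simp add: complex_euclidean_def)
  next
    case (4 x)
    have "sqrt (Re (hinner ?E x x)) \<ge> 0"
      by (simp flip: hnorm_def add: hnorm_complex_euclidean)
    then show ?case by simp
  next
    case (6 s)
    have "Cauchy s"
      using 6(2) by (force simp: Cauchy_iff minus hnorm_complex_euclidean)
    then obtain l where "s \<longlonglongrightarrow> l"
      using Cauchy_convergent convergent_def by blast
    then have "(\<lambda>n. norm (s n - l)) \<longlonglongrightarrow> 0"
      using LIM_zero tendsto_norm_zero by blast
    then show ?case
      by (intro bexI[of _ l]) (simp_all add: minus hnorm_complex_euclidean, simp add: complex_euclidean_def)
  qed (simp_all add: complex_euclidean_def algebra_simps sum.distrib sum_distrib_left)
qed


section \<open>The rotation invariant probability measure on the unit sphere\<close>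

text \<open>
  The image of the uniform distribution on the unit ball under \<open>x \<mapsto> x / \<parallel>x\<parallel>\<close>, as a Borel measure on
  the whole space. The lemmas below show that this is a probability measure carried by the unit
  sphere and invariant under all orthogonal transformations, which determines it uniquely.
\<close>

definition sphere_measure :: "(real ^ 'm::finite) measure" where
  "sphere_measure = distr (uniform_measure lborel (ball 0 1)) borel sgn"

lemma emeasure_unit_ball:
  "emeasure lborel (ball (0::'a::euclidean_space) 1) \<noteq> 0"
  "emeasure lborel (ball (0::'a::euclidean_space) 1) \<noteq> \<infinity>"
  using unit_ball_vol_pos[of "real DIM('a)"]
  by (auto simp: emeasure_ball simp del: unit_ball_vol_pos)

lemma borel_measurable_sgn_vec [measurable]: "(sgn :: real ^ 'm::finite \<Rightarrow> _) \<in> borel_measurable borel"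
  unfolding sgn_div_norm by measurable

lemma prob_space_sphere_measure: "prob_space (sphere_measure :: (real ^ 'm::finite) measure)"
  unfolding sphere_measure_def
  by (intro prob_space.prob_space_distr prob_space_uniform_measure emeasure_unit_ball)
     (simp_all cong: measurable_cong_sets)

lemma AE_sphere_measure: "AE x in (sphere_measure :: (real ^ 'm::finite) measure). x \<in> sphere 0 1"
proof -
  have "AE x in lborel. x \<in> ball (0::real^'m) 1 \<longrightarrow> sgn x \<in> sphere 0 1"
    using AE_lborel_singleton[of 0] by eventually_elim (simp add: norm_sgn)
  then show ?thesis
    unfolding sphere_measure_def
    by (subst AE_distr_iff) (auto intro!: AE_uniform_measureI cong: measurable_cong_sets)
qed

lemma lborel_distr_orthogonal:
  fixes f :: "'a::euclidean_space \<Rightarrow> 'a"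
  assumes f: "orthogonal_transformation f"
  shows "distr lborel borel f = lborel"
proof (rule measure_eqI)
  have lin: "linear f" using f by (rule orthogonal_transformation_linear)
  then have meas [measurable]: "f \<in> borel_measurable borel"
    by (intro borel_measurable_continuous_onI linear_continuous_on) (simp add: linear_conv_bounded_linear)
  have nf: "norm (f x) = norm x" for x using f by (rule orthogonal_transformation_norm)
  have surj: "surj f" using f by (rule orthogonal_transformation_surj)
  define B where "B = ball (0::'a) 1"
  have B [measurable]: "B \<in> sets borel" by (simp add: B_def)
  have fB: "f x \<in> B \<longleftrightarrow> x \<in> B" for x by (simp add: B_def nf)
  have mB: "- x \<in> B \<longleftrightarrow> x \<in> B" for x by (simp add: B_def)
  have transl: "(\<integral>\<^sup>+y. h (c + y) \<partial>lborel) = (\<integral>\<^sup>+y. h y \<partial>lborel)"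
    if [measurable]: "h \<in> borel_measurable borel" for h :: "'a \<Rightarrow> ennreal" and c
  proof -
    have "(\<integral>\<^sup>+y. h y \<partial>lborel) = (\<integral>\<^sup>+y. h y \<partial>distr lborel borel ((+) c))"
      by (simp add: lborel_distr_plus)
    also have "\<dots> = (\<integral>\<^sup>+y. h (c + y) \<partial>lborel)"
      by (subst nn_integral_distr) auto
    finally show ?thesis by simp
  qed
  have tr: "(\<integral>\<^sup>+y. indicator S (c + y) \<partial>lborel) = emeasure lborel S" if "S \<in> sets borel" for S :: "'a set" and c
    using that by (subst transl) auto
  fix A assume "A \<in> sets (distr lborel borel f)"
  then have A [measurable]: "A \<in> sets borel" by simp
  have "emeasure (distr lborel borel f) A = (\<integral>\<^sup>+x. indicator A (f x) \<partial>lborel)"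
  proof -
    have "emeasure (distr lborel borel f) A = (\<integral>\<^sup>+y. indicator A y \<partial>distr lborel borel f)"
      by simp
    also have "\<dots> = (\<integral>\<^sup>+x. indicator A (f x) \<partial>lborel)"
      by (rule nn_integral_distr) measurable
    finally show ?thesis .
  qed
  then have "emeasure (distr lborel borel f) A * emeasure lborel B =
        (\<integral>\<^sup>+x. indicator A (f x) * emeasure lborel B \<partial>lborel)"
    by (simp add: nn_integral_multc)
  also have "\<dots> = (\<integral>\<^sup>+x. (\<integral>\<^sup>+y. indicator A (f x) * indicator B (- f x + y) \<partial>lborel) \<partial>lborel)"
    by (subst nn_integral_cmult) (measurable, simp only: tr[OF B])
  also have "\<dots> = (\<integral>\<^sup>+y. (\<integral>\<^sup>+x. indicator A (f x) * indicator B (- f x + y) \<partial>lborel) \<partial>lborel)"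
    by (rule lborel_pair.Fubini') measurable
  also have "\<dots> = (\<integral>\<^sup>+y. (\<integral>\<^sup>+x. indicator A (f x + y) * indicator B (f x) \<partial>lborel) \<partial>lborel)"
  proof (rule nn_integral_cong)
    fix y
    obtain z where z: "y = f z" using surj by blast
    show "(\<integral>\<^sup>+x. indicator A (f x) * indicator B (- f x + y) \<partial>lborel) =
          (\<integral>\<^sup>+x. indicator A (f x + y) * indicator B (f x) \<partial>lborel)"
      by (subst transl[of _ z, symmetric])
         (auto simp: z mB linear_add[OF lin] indicator_def add_ac intro!: nn_integral_cong)
  qed
  also have "\<dots> = (\<integral>\<^sup>+x. (\<integral>\<^sup>+y. indicator A (f x + y) * indicator B (f x) \<partial>lborel) \<partial>lborel)"
    by (rule lborel_pair.Fubini') measurable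
  also have "\<dots> = (\<integral>\<^sup>+x. emeasure lborel A * indicator B x \<partial>lborel)"
    by (subst nn_integral_multc) (measurable, simp only: tr[OF A], simp add: indicator_def fB)
  also have "\<dots> = emeasure lborel A * emeasure lborel B"
    by (simp add: nn_integral_cmult)
  finally show "emeasure (distr lborel borel f) A = emeasure lborel A"
    using emeasure_unit_ball[where 'a='a] unfolding B_def by (metis infinity_ennreal_def mult_divide_eq_ennreal)
qed simp

lemma sphere_measure_orthogonal_invariant:
  fixes f :: "real ^ 'm::finite \<Rightarrow> real ^ 'm"
  assumes f: "orthogonal_transformation f"
  shows "distr sphere_measure borel f = sphere_measure"
proof -
  have lin: "linear f" using f by (rule orthogonal_transformation_linear)
  then have meas [measurable]: "f \<in> borel_measurable borel"
    by (intro borel_measurable_continuous_onI linear_continuous_on) (simp add: linear_conv_bounded_linear)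
  have nf: "norm (f x) = norm x" for x using f by (rule orthogonal_transformation_norm)
  have comm: "f \<circ> sgn = sgn \<circ> f"
    by (auto simp: fun_eq_iff sgn_div_norm nf linear_cmul[OF lin])
  let ?U = "uniform_measure lborel (ball 0 1) :: (real ^ 'm) measure"
  have "distr ?U borel f = ?U"
  proof (rule measure_eqI)
    fix A assume "A \<in> sets (distr ?U borel f)"
    then have A [measurable]: "A \<in> sets borel" by simp
    have fA: "f -` A \<in> sets borel" using measurable_sets[OF meas A] by simp
    have "emeasure (distr ?U borel f) A = emeasure ?U (f -` A)"
      by (subst emeasure_distr) (auto cong: measurable_cong_sets)
    also have "\<dots> = emeasure lborel (ball 0 1 \<inter> f -` A) / emeasure lborel (ball (0::real^'m) 1)"
      using fA by simp
    also have "ball 0 1 \<inter> f -` A = f -` (ball 0 1 \<inter> A)"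
      by (auto simp: nf)
    also have "emeasure lborel (f -` (ball 0 1 \<inter> A)) = emeasure (distr lborel borel f) (ball 0 1 \<inter> A)"
      by (subst emeasure_distr) auto
    also have "\<dots> = emeasure lborel (ball 0 1 \<inter> A)"
      by (simp add: lborel_distr_orthogonal[OF f])
    finally show "emeasure (distr ?U borel f) A = emeasure ?U A" by simp
  qed simp
  then have "distr (distr ?U borel f) borel sgn = distr ?U borel sgn" by simp
  moreover have "distr (distr ?U borel f) borel sgn = distr (distr ?U borel sgn) borel f"
    by (subst (1 2) distr_distr) (auto simp: comm cong: measurable_cong_sets)
  ultimately show ?thesis by (simp add: sphere_measure_def)
qed


section \<open>The constant \<open>\<vartheta>\<close>\<close>

definition psd_matrix :: "real ^ 'm ^ 'm::finite \<Rightarrow> bool" where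
  "psd_matrix P \<longleftrightarrow> transpose P = P \<and> (\<forall>x. 0 \<le> x \<bullet> (P *v x))"

text \<open>\<open>\<bar>B\<bar>\<close> is the positive semidefinite square root of \<open>B\<^sup>* B\<close>.\<close>

definition matrix_abs :: "real ^ 'm ^ 'm::finite \<Rightarrow> real ^ 'm ^ 'm" where
  "matrix_abs B = (THE P. psd_matrix P \<and> P ** P = transpose B ** B)"

text \<open>
  The dimension \<open>m\<close> is the cardinality of the index type \<open>'m\<close>. The infimum is a minimum, since it is
  taken of a continuous function over a compact set of matrices.
\<close>

definition vartheta :: "'m::finite itself \<Rightarrow> real" where
  "vartheta (_ :: 'm itself) =
     1 / Inf {(\<integral>\<xi>. \<bar>\<xi> \<bullet> (B *v \<xi>)\<bar> \<partial>sphere_measure) | B :: real ^ 'm ^ 'm.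
                transpose B = B \<and> trace (matrix_abs B) = real CARD('m)}"

end

theory Submission
  imports Defs
begin

text \<open>
  Write \<open>\<vartheta>\<close> for \<open>\<vartheta>(2d)\<close> and \<open>\<xi> \<in> \<real>\<^sup>2\<^sup>d\<close> for a random unit vector, read as a complex vector \<open>z \<in> \<complex>\<^sup>d\<close>
  by grouping coordinates. A single finite-dimensional space already works: \<open>\<H>\<close> is \<open>\<complex>\<^sup>n\<close>, the
  operators are the diagonal contractions, and \<open>V\<close> maps \<open>w\<close> to the tuple of inner products
  \<open>\<langle>w, z\<^sub>k\<rangle>\<close> with the vectors of a tight frame of \<open>\<complex>\<^sup>d\<close>. The compressions of the diagonal operators
  are then the combinations \<open>\<Sum>k. F\<^sub>k z\<^sub>k z\<^sub>k\<^sup>*\<close> with \<open>\<bar>F\<^sub>k\<bar> \<le> 1\<close>, up to normalisation, so the question is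
  how large a multiple of the unit ball of matrices these combinations fill.

  For real symmetric matrices, let \<open>m = 2d\<close>. If the frame consisted of all unit vectors with uniform
  weight, the support function of the convex set \<open>{m \<integral> f \<xi>\<xi>\<^sup>T | \<bar>f\<bar> \<le> 1}\<close> at a symmetric matrix \<open>B\<close>
  would be \<open>m \<integral> \<bar>\<xi>\<^sup>T B \<xi>\<bar>\<close>. By the definition of \<open>\<vartheta>\<close> it is at least \<open>tr \<bar>B\<bar> / \<vartheta>\<close>, and \<open>tr \<bar>B\<bar>\<close> is the
  support function of the symmetric contractions. Hence every symmetric contraction divided by \<open>\<vartheta>\<close>
  would be in the set. For a finite frame (lemma \<open>parseval_frame_compressions\<close>) the unit vectors are
  rounded to a finite grid. The error in the integral is bounded by twice the mesh times \<open>tr \<bar>B\<bar>\<close>, so it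
  only multiplies \<open>1/\<vartheta>\<close> by a factor \<open>s < 1\<close> as close to \<open>1\<close> as desired. Rounding towards the origin
  by an odd function in each coordinate keeps the second moment matrix diagonal and can only
  decrease it; a few multiples of the standard basis vectors restore it to the identity. With
  finitely many vectors, the set of compressions is a zonotope, hence compact, and membership
  follows from separation (lemma \<open>zonotope_membership\<close>).

  For complex matrices, writing a contraction \<open>X\<close> as \<open>A + iB\<close> with \<open>A\<close>, \<open>B\<close> Hermitian contractions costs
  a factor \<open>\<surd>2\<close>, since \<open>\<bar>f + ig\<bar>\<close> can be \<open>\<surd>2\<close> for \<open>f, g \<in> [-1, 1]\<close>, and leaves no room for \<open>s < 1\<close>.
  Three directions do better: if \<open>\<omega>\<close> is a primitive cube root of unity, then \<open>X\<close> is \<open>2/3\<close> times the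
  sum of \<open>e\<^sup>-\<^sup>1 Herm(eX)\<close> over \<open>e = 1, \<omega>, \<omega>\<^sup>2\<close>, because \<open>1 + \<omega>\<^sup>2 + \<omega>\<^sup>4 = 0\<close> cancels the \<open>X\<^sup>*\<close> terms, while
  \<open>\<bar>a + b\<omega>\<^sup>2 + c\<omega>\<bar> \<le> 2\<close> for \<open>a, b, c \<in> [-1, 1]\<close>. The cost is \<open>4/3 < \<surd>2\<close>, and \<open>s = 19/20\<close> fits into
  the gap.
\<close>

section \<open>Zonotopes\<close>

text \<open>
  A sum of segments \<open>[-v\<^sub>k, v\<^sub>k]\<close> is compact and convex, with support function \<open>\<Sum>k. \<bar>w \<bullet> v\<^sub>k\<bar>\<close>, so
  a point obeying all the support inequalities cannot be separated from it.
\<close>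

lemma zonotope_membership:
  fixes v :: "'k \<Rightarrow> 'a::euclidean_space"
  assumes "finite K" and *: "\<And>w. w \<bullet> a \<le> (\<Sum>k\<in>K. \<bar>w \<bullet> v k\<bar>)"
  shows "\<exists>f. (\<forall>k. \<bar>f k\<bar> \<le> 1) \<and> a = (\<Sum>k\<in>K. f k *\<^sub>R v k)"
proof -
  define Z where "Z L = {\<Sum>k\<in>L. f k *\<^sub>R v k | f. \<forall>k. \<bar>f k\<bar> \<le> (1::real)}" for L
  have "compact (Z L) \<and> convex (Z L)" if "finite L" for L
    using that
  proof induction
    case empty
    have "\<exists>f::'k \<Rightarrow> real. \<forall>k. \<bar>f k\<bar> \<le> 1" by (rule exI[of _ "\<lambda>_. 0"]) simp
    then show ?case by (simp add: Z_def)
  next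
    case (insert k L)
    have img: "(\<lambda>t. t *\<^sub>R v k) ` {-1..1} = closed_segment (- v k) (v k)"
    proof -
      have "linear (\<lambda>t. t *\<^sub>R v k)" by (auto intro: linearI simp: algebra_simps)
      from closed_segment_linear_image[OF this, of "-1" 1]
      have "closed_segment (- v k) (v k) = (\<lambda>t. t *\<^sub>R v k) ` closed_segment (-1) 1" by simp
      then show ?thesis by (simp add: closed_segment_eq_real_ivl)
    qed
    have "Z (insert k L) = {x + y | x y. x \<in> closed_segment (- v k) (v k) \<and> y \<in> Z L}"
    proof (intro equalityI subsetI)
      fix x assume "x \<in> Z (insert k L)"
      then obtain f where f: "\<forall>k. \<bar>f k\<bar> \<le> 1" "x = (\<Sum>k\<in>insert k L. f k *\<^sub>R v k)"
        by (auto simp: Z_def)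
      have "f k *\<^sub>R v k \<in> (\<lambda>t. t *\<^sub>R v k) ` {-1..1}"
        using f(1)[rule_format, of k] by (intro imageI) (simp add: abs_le_iff)
      moreover have "(\<Sum>k\<in>L. f k *\<^sub>R v k) \<in> Z L" using f by (auto simp: Z_def)
      ultimately show "x \<in> {x + y | x y. x \<in> closed_segment (- v k) (v k) \<and> y \<in> Z L}"
        using f insert by (auto simp: img)
    next
      fix x assume "x \<in> {x + y | x y. x \<in> closed_segment (- v k) (v k) \<and> y \<in> Z L}"
      then obtain t f where t: "t \<in> {-1..1}" and f: "\<forall>k. \<bar>f k\<bar> \<le> 1"
        and x: "x = t *\<^sub>R v k + (\<Sum>k\<in>L. f k *\<^sub>R v k)"
        unfolding Z_def img[symmetric] by auto
      have "x = (\<Sum>j\<in>insert k L. (f(k := t)) j *\<^sub>R v j)"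
        using insert by (subst sum.insert) (auto simp: x intro!: sum.cong)
      moreover have "\<forall>j. \<bar>(f(k := t)) j\<bar> \<le> 1" using t f by auto
      ultimately show "x \<in> Z (insert k L)" unfolding Z_def by blast
    qed
    moreover have "compact {x + y | x y. x \<in> closed_segment (- v k) (v k) \<and> y \<in> Z L}"
      by (rule compact_sums) (use insert in auto)
    moreover have "convex {x + y | x y. x \<in> closed_segment (- v k) (v k) \<and> y \<in> Z L}"
    proof -
      have "convex (\<Union>x\<in>closed_segment (- v k) (v k). \<Union>y\<in>Z L. {x + y})"
        by (rule convex_sums) (use insert in auto)
      moreover have "(\<Union>x\<in>closed_segment (- v k) (v k). \<Union>y\<in>Z L. {x + y}) =
        {x + y | x y. x \<in> closed_segment (- v k) (v k) \<and> y \<in> Z L}" by auto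
      ultimately show ?thesis by metis
    qed
    ultimately show ?case by simp
  qed
  then have Z: "closed (Z K)" "convex (Z K)" using \<open>finite K\<close> compact_imp_closed by blast+
  have "a \<in> Z K"
  proof (rule ccontr)
    assume "a \<notin> Z K"
    then obtain w b where w: "w \<bullet> a < b" "\<forall>x\<in>Z K. b < w \<bullet> x"
      using separating_hyperplane_closed_point[OF Z(2,1)] by blast
    \<comment> \<open>the vertex of the zonotope that minimises the separating functional\<close>
    define f where "f k = - sgn (w \<bullet> v k)" for k
    have "(\<Sum>k\<in>K. f k *\<^sub>R v k) \<in> Z K"
      unfolding Z_def by (intro CollectI exI[of _ f]) (simp add: f_def abs_sgn_eq)
    with w(2) have "b < (\<Sum>k\<in>K. w \<bullet> (f k *\<^sub>R v k))" by (auto simp: inner_sum_right)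
    also have "\<dots> = - (\<Sum>k\<in>K. \<bar>w \<bullet> v k\<bar>)"
      unfolding sum_negf[symmetric] by (intro sum.cong) (auto simp: f_def abs_sgn mult.commute)
    also have "\<dots> = - (\<Sum>k\<in>K. \<bar>(- w) \<bullet> v k\<bar>)" by simp
    also have "\<dots> \<le> w \<bullet> a" using *[of "- w"] by simp
    finally show False using w(1) by simp
  qed
  then show ?thesis by (auto simp: Z_def)
qed


section \<open>Eigenbases of symmetric matrices and the trace of the absolute value\<close>

lemma symmetric_matrix_inner:
  fixes B :: "real ^ 'm ^ 'm::finite"
  assumes "transpose B = B"
  shows "x \<bullet> (B *v y) = (B *v x) \<bullet> y"
  using dot_lmul_matrix[of x B y] assms by (metis transpose_matrix_vector)

text \<open>
  A maximiser \<open>u\<close> of the Rayleigh quotient on the unit sphere of \<open>S\<close>, with maximum \<open>l\<close>, is an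
  eigenvector: moving from \<open>u\<close> in the direction of the residual \<open>g = B u - l u\<close> would increase the
  quotient to first order unless \<open>g = 0\<close>.
\<close>

lemma symmetric_eigenvector_exists:
  fixes B :: "real ^ 'm ^ 'm::finite"
  assumes sym: "transpose B = B" and S: "subspace S" and inv: "\<And>x. x \<in> S \<Longrightarrow> B *v x \<in> S"
    and nz: "S \<noteq> {0}"
  shows "\<exists>u\<in>S. norm u = 1 \<and> (\<exists>l. B *v u = l *\<^sub>R u)"
proof -
  note adj = symmetric_matrix_inner[OF sym]
  let ?K = "S \<inter> sphere 0 1"
  have "compact ?K" by (rule closed_Int_compact) (auto simp: closed_subspace S)
  moreover obtain x where "x \<in> S" "x \<noteq> 0" using nz subspace_0[OF S] by blast
  then have "x /\<^sub>R norm x \<in> ?K" using S by (simp add: subspace_scale)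
  then have "?K \<noteq> {}" by blast
  moreover have contB: "continuous_on ?K (\<lambda>y. y \<bullet> (B *v y))"
    by (intro continuous_intros matrix_vector_mult_linear_continuous_on)
  ultimately obtain u where u: "u \<in> ?K" and mx: "\<And>y. y \<in> ?K \<Longrightarrow> y \<bullet> (B *v y) \<le> u \<bullet> (B *v u)"
    using continuous_attains_sup[of ?K "\<lambda>y. y \<bullet> (B *v y)"]
    using contB by blast
  define l where "l = u \<bullet> (B *v u)"
  have uS: "u \<in> S" and uu: "u \<bullet> u = 1" using u by (auto simp: dot_square_norm)
  have q: "y \<bullet> (B *v y) \<le> l * (y \<bullet> y)" if "y \<in> S" for y
  proof (cases "y = 0")
    case False
    then have "y /\<^sub>R norm y \<in> ?K" using S that by (simp add: subspace_scale)
    from mx[OF this] have "(y \<bullet> (B *v y)) / (norm y)\<^sup>2 \<le> l"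
      by (simp add: matrix_vector_mult_scaleR l_def power2_eq_square divide_simps)
    then show ?thesis using False by (simp add: divide_le_eq dot_square_norm)
  qed simp
  define g where "g = B *v u - l *\<^sub>R u"
  have gS: "g \<in> S" using inv uS S by (simp add: g_def subspace_diff subspace_scale)
  have gg: "g \<bullet> g = g \<bullet> (B *v u) - l * (g \<bullet> u)"
    unfolding g_def by (simp add: inner_diff)
  \<comment> \<open>the first-order gain of \<open>u + t g\<close> is at most its second-order loss\<close>
  have key: "2 * t * (g \<bullet> g) \<le> t\<^sup>2 * (l * (g \<bullet> g) - g \<bullet> (B *v g))" for t
  proof -
    have ug: "u \<bullet> (B *v g) = g \<bullet> (B *v u)" using adj[of u g] by (simp only: inner_commute[of g])
    have "(u + t *\<^sub>R g) \<bullet> (B *v (u + t *\<^sub>R g)) = l + 2 * t * (g \<bullet> (B *v u)) + t\<^sup>2 * (g \<bullet> (B *v g))"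
      by (simp add: matrix_vector_right_distrib inner_add_left inner_add_right ug
          matrix_vector_mult_scaleR l_def power2_eq_square algebra_simps)
    moreover have "(u + t *\<^sub>R g) \<bullet> (u + t *\<^sub>R g) = 1 + 2 * t * (g \<bullet> u) + t\<^sup>2 * (g \<bullet> g)"
      by (simp add: inner_add_left inner_add_right uu inner_commute[of u g] power2_eq_square algebra_simps)
    moreover have "u + t *\<^sub>R g \<in> S" using uS gS S by (simp add: subspace_add subspace_scale)
    ultimately have "l + 2 * t * (g \<bullet> (B *v u)) + t\<^sup>2 * (g \<bullet> (B *v g)) \<le> l * (1 + 2 * t * (g \<bullet> u) + t\<^sup>2 * (g \<bullet> g))"
      using q[of "u + t *\<^sub>R g"] by simp
    then show ?thesis unfolding gg by (simp add: algebra_simps)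
  qed
  have "g \<bullet> g = 0"
  proof (rule ccontr)
    assume "g \<bullet> g \<noteq> 0"
    then have pos: "g \<bullet> g > 0" by simp
    define M where "M = \<bar>l * (g \<bullet> g) - g \<bullet> (B *v g)\<bar> + 1"
    have M: "M > 0" "l * (g \<bullet> g) - g \<bullet> (B *v g) < M" by (auto simp: M_def)
    define t where "t = (g \<bullet> g) / M"
    have t: "t > 0" using pos M by (simp add: t_def)
    have "t\<^sup>2 * (l * (g \<bullet> g) - g \<bullet> (B *v g)) \<le> t\<^sup>2 * M" using M(2) by (intro mult_left_mono) auto
    then have "2 * t * (g \<bullet> g) \<le> t\<^sup>2 * M" using key[of t] by linarith
    also have "\<dots> = t * (g \<bullet> g)" using M by (simp add: t_def power2_eq_square)
    finally show False using mult_pos_pos[OF t pos] by simp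
  qed
  then have "B *v u = l *\<^sub>R u" by (simp add: g_def)
  then show ?thesis using u by auto
qed

definition orthonormal_basis :: "'a::euclidean_space set \<Rightarrow> bool" where
  "orthonormal_basis E \<longleftrightarrow> finite E \<and> pairwise orthogonal E \<and> (\<forall>e\<in>E. norm e = 1) \<and> span E = UNIV"

text \<open>
  The induction is over invariant subspaces: the orthogonal complement of an eigenvector is again
  invariant.
\<close>

lemma symmetric_matrix_eigenbasis:
  fixes B :: "real ^ 'm ^ 'm::finite"
  assumes sym: "transpose B = B"
  obtains E where "orthonormal_basis E" "\<And>e. e \<in> E \<Longrightarrow> B *v e = (e \<bullet> (B *v e)) *\<^sub>R e"
proof -
  note adj = symmetric_matrix_inner[OF sym]
  have "\<exists>E. finite E \<and> E \<subseteq> S \<and> pairwise orthogonal E \<and> (\<forall>e\<in>E. norm e = 1 \<and> (\<exists>l. B *v e = l *\<^sub>R e)) \<and> span E = S"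
    if "subspace S" "\<And>x. x \<in> S \<Longrightarrow> B *v x \<in> S" for S
    using that
  proof (induction "dim S" arbitrary: S rule: less_induct)
    case (less S)
    show ?case
    proof (cases "S = {0}")
      case True
      then show ?thesis by (intro exI[of _ "{}"]) auto
    next
      case False
      then obtain u l where u: "u \<in> S" "norm u = 1" "B *v u = l *\<^sub>R u"
        using symmetric_eigenvector_exists[OF sym less.prems] by blast
      have uu: "u \<bullet> u = 1" using u by (simp add: dot_square_norm)
      define S' where "S' = {x \<in> S. u \<bullet> x = 0}"
      have S': "subspace S'" using less.prems(1)
        by (auto simp: S'_def subspace_def inner_add_right)
      have inv': "B *v x \<in> S'" if "x \<in> S'" for x
        using that less.prems(2) adj[of u x] u(3) by (simp add: S'_def)
      have "u \<notin> S'" using uu by (simp add: S'_def)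
      moreover have "S' \<subseteq> S" by (auto simp: S'_def)
      ultimately have "S' \<subset> S" using u(1) by blast
      then have "dim S' < dim S" using S' less.prems(1)
        by (intro dim_psubset) (simp add: span_eq_iff[THEN iffD2])
      then obtain E where E: "finite E" "E \<subseteq> S'" "pairwise orthogonal E"
        "\<forall>e\<in>E. norm e = 1 \<and> (\<exists>l. B *v e = l *\<^sub>R e)" "span E = S'"
        using less.hyps[OF _ S' inv'] by blast
      have "span (insert u E) = S"
      proof
        show "span (insert u E) \<subseteq> S"
          using u E(2) less.prems(1) by (intro span_minimal) (auto simp: S'_def)
        show "S \<subseteq> span (insert u E)"
        proof
          fix x assume x: "x \<in> S"
          have "x - (u \<bullet> x) *\<^sub>R u \<in> span E"
            using x u uu less.prems(1) by (simp add: E(5) S'_def subspace_diff subspace_scale inner_diff_right)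
          then show "x \<in> span (insert u E)" using span_breakdown_eq by blast
        qed
      qed
      moreover have "pairwise orthogonal (insert u E)"
        using E(2,3) by (auto simp: pairwise_insert orthogonal_def S'_def inner_commute)
      ultimately show ?thesis using E u by (intro exI[of _ "insert u E"]) (auto simp: S'_def)
    qed
  qed
  from this[of UNIV] obtain E where E: "finite E" "pairwise orthogonal E"
    "\<forall>e\<in>E. norm e = 1 \<and> (\<exists>l. B *v e = l *\<^sub>R e)" "span E = UNIV" by auto
  show ?thesis
  proof (rule that[of E])
    show "orthonormal_basis E" using E by (auto simp: orthonormal_basis_def)
    fix e assume "e \<in> E"
    then obtain l where "norm e = 1" "B *v e = l *\<^sub>R e" using E by blast
    then show "B *v e = (e \<bullet> (B *v e)) *\<^sub>R e" by (simp add: dot_square_norm)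
  qed
qed

lemma orthonormal_basis_expansion:
  fixes x :: "'a::euclidean_space"
  assumes "orthonormal_basis E"
  shows "x = (\<Sum>e\<in>E. (e \<bullet> x) *\<^sub>R e)"
proof -
  have E: "finite E" "pairwise orthogonal E" "\<And>e. e \<in> E \<Longrightarrow> e \<bullet> e = 1" "span E = UNIV"
    using assms by (auto simp: orthonormal_basis_def dot_square_norm)
  obtain c where c: "x = (\<Sum>e\<in>E. c e *\<^sub>R e)"
    using span_finite[OF E(1)] E(4) by (metis (no_types, lifting) UNIV_I rangeE)
  have "e \<bullet> x = c e" if e: "e \<in> E" for e
  proof -
    have "e \<bullet> x = (\<Sum>e'\<in>E. if e' = e then c e else 0)"
      unfolding c inner_sum_right
      by (intro sum.cong) (use E e in \<open>auto simp: pairwise_def orthogonal_def\<close>)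
    then show ?thesis using E e by simp
  qed
  then show ?thesis using c by (metis (no_types, lifting) sum.cong)
qed

lemma orthonormal_basis_inner:
  fixes x :: "'a::euclidean_space"
  assumes "orthonormal_basis E"
  shows "x \<bullet> y = (\<Sum>e\<in>E. (e \<bullet> x) * (e \<bullet> y))"
  by (subst orthonormal_basis_expansion[OF assms, of y])
     (simp add: inner_sum_right inner_commute mult.commute)

text \<open>
  Inserting Parseval's identity for the standard basis vectors turns the sum over \<open>E\<close> into the sum
  over the diagonal.
\<close>

lemma trace_orthonormal_basis:
  fixes M :: "real ^ 'm ^ 'm::finite"
  assumes "orthonormal_basis E"
  shows "trace M = (\<Sum>e\<in>E. e \<bullet> (M *v e))"
proof -
  have "(\<Sum>e\<in>E. e \<bullet> (M *v e)) = (\<Sum>e\<in>E. \<Sum>i\<in>UNIV. \<Sum>j\<in>UNIV. M$i$j * ((e \<bullet> axis i 1) * (e \<bullet> axis j 1)))"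
    unfolding inner_axis by (simp add: inner_vec_def matrix_vector_mult_def sum_distrib_left algebra_simps)
  also have "\<dots> = (\<Sum>i\<in>UNIV. \<Sum>j\<in>UNIV. M$i$j * (\<Sum>e\<in>E. (e \<bullet> axis i 1) * (e \<bullet> axis j 1)))"
    by (subst sum.swap, intro sum.cong refl, subst sum.swap) (simp add: sum_distrib_left)
  also have "\<dots> = (\<Sum>i\<in>UNIV. \<Sum>j\<in>UNIV. M$i$j * (axis i 1 \<bullet> axis j (1::real)))"
    by (simp only: orthonormal_basis_inner[OF assms, symmetric])
  also have "\<dots> = trace M"
    by (simp add: inner_axis_axis trace_def if_distrib[of "(*) _"] cong: if_cong)
  finally show ?thesis by simp
qed

text \<open>
  This gives uniqueness of the positive semidefinite square root. The vector \<open>w = Q e - l e\<close> satisfies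
  \<open>Q w = - l w\<close>, which semidefiniteness permits only if \<open>w = 0\<close> or \<open>l = 0\<close>; in the latter case
  \<open>\<parallel>Q e\<parallel>\<^sup>2 = e \<bullet> Q\<^sup>2 e = 0\<close>.
\<close>

lemma psd_matrix_eigenvector_of_square:
  fixes Q :: "real ^ 'm ^ 'm::finite"
  assumes Q: "psd_matrix Q" and e: "Q *v (Q *v e) = l\<^sup>2 *\<^sub>R e" and l: "0 \<le> l"
  shows "Q *v e = l *\<^sub>R e"
proof -
  note adj = symmetric_matrix_inner[of Q]
  have sym: "transpose Q = Q" and pos: "\<And>x. 0 \<le> x \<bullet> (Q *v x)" using Q by (auto simp: psd_matrix_def)
  define w where "w = Q *v e - l *\<^sub>R e"
  have Qw: "Q *v w = - l *\<^sub>R w"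
    by (simp add: w_def matrix_vector_mult_diff_distrib matrix_vector_mult_scaleR e power2_eq_square algebra_simps)
  have "l * (w \<bullet> w) \<le> 0" using pos[of w] by (simp add: Qw)
  then have "l = 0 \<or> w = 0" using l by (simp add: mult_le_0_iff) (metis inner_gt_zero_iff not_le)
  then consider "l = 0" | "w = 0" by blast
  then show ?thesis
  proof cases
    case 1
    have "(Q *v e) \<bullet> (Q *v e) = e \<bullet> (Q *v (Q *v e))" using adj[OF sym, of e "Q *v e"] by simp
    then show ?thesis using e 1 by simp
  qed (simp add: w_def)
qed

text \<open>
  The matrix with the same eigenbasis and the absolute values of the eigenvalues is a positive
  semidefinite square root of \<open>B\<^sup>* B\<close>. Any other one acts on each eigenvector in the same way, so the
  definite description in \<^const>\<open>matrix_abs\<close> picks this matrix.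
\<close>

lemma matrix_abs_eigenvector:
  fixes B :: "real ^ 'm ^ 'm::finite"
  assumes sym: "transpose B = B" and E: "orthonormal_basis E"
    and eig: "\<And>e. e \<in> E \<Longrightarrow> B *v e = l e *\<^sub>R e" and "e \<in> E"
  shows "matrix_abs B *v e = \<bar>l e\<bar> *\<^sub>R e"
proof -
  define g where "g x = (\<Sum>e\<in>E. (\<bar>l e\<bar> * (e \<bullet> x)) *\<^sub>R e)" for x
  have lin: "linear g"
    by (auto simp: g_def algebra_simps inner_add_right sum.distrib scaleR_sum_right intro!: linearI)
  \<comment> \<open>the candidate for the absolute value, as a matrix\<close>
  define P where "P = matrix g"
  have Px: "P *v x = g x" for x using fun_cong[OF matrix_vector_mul(2)[OF lin], of x] by (simp add: P_def)
  have onb: "finite E" "\<And>e e'. e \<in> E \<Longrightarrow> e' \<in> E \<Longrightarrow> e \<bullet> e' = (if e = e' then 1 else 0)"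
    using E by (auto simp: orthonormal_basis_def pairwise_def orthogonal_def dot_square_norm)
  have Pe: "P *v e = \<bar>l e\<bar> *\<^sub>R e" if "e \<in> E" for e
  proof -
    have "g e = (\<Sum>e'\<in>E. if e' = e then \<bar>l e\<bar> *\<^sub>R e else 0)"
      unfolding g_def by (intro sum.cong) (use that onb in auto)
    then show ?thesis using that onb by (simp add: Px)
  qed
  have gi: "x \<bullet> g y = (\<Sum>e\<in>E. \<bar>l e\<bar> * (e \<bullet> x) * (e \<bullet> y))" for x y
    by (simp add: g_def inner_sum_right inner_commute algebra_simps)
  have ext: "M = M'" if "\<And>e. e \<in> E \<Longrightarrow> M *v e = M' *v e" for M M' :: "real ^ 'm ^ 'm"
  proof -
    have "M *v (\<Sum>e\<in>E. (e \<bullet> x) *\<^sub>R e) = M' *v (\<Sum>e\<in>E. (e \<bullet> x) *\<^sub>R e)" for x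
      by (simp add: that linear_sum[OF matrix_vector_mul_linear] matrix_vector_mult_scaleR)
    from this have "M *v x = M' *v x" for x by (simp only: orthonormal_basis_expansion[OF E, symmetric])
    then show ?thesis by (simp add: matrix_eq)
  qed
  have "transpose P = P"
  proof (subst matrix_eq, intro allI)
    fix x
    have "y \<bullet> (transpose P *v x) = y \<bullet> (P *v x)" for y
      using dot_lmul_matrix[of x P y]
      by (simp add: Px gi mult_ac inner_commute[of y] )
    then show "transpose P *v x = P *v x" using vector_eq_ldot by blast
  qed
  moreover have "0 \<le> x \<bullet> (P *v x)" for x
    unfolding Px gi by (intro sum_nonneg) (simp add: mult.assoc)
  ultimately have psd: "psd_matrix P" by (simp add: psd_matrix_def)
  have sq: "(B ** B) *v e = (l e)\<^sup>2 *\<^sub>R e" if "e \<in> E" for e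
    using that by (simp add: eig matrix_vector_mul_assoc[symmetric] matrix_vector_mult_scaleR power2_eq_square)
  have PP: "P ** P = B ** B"
    by (rule ext) (simp add: eig Pe matrix_vector_mul_assoc[symmetric] matrix_vector_mult_scaleR power2_eq_square)
  have "matrix_abs B = P"
    unfolding matrix_abs_def sym
  proof (rule the_equality)
    fix Q :: "real ^ 'm ^ 'm" assume Q: "psd_matrix Q \<and> Q ** Q = B ** B"
    show "Q = P"
    proof (rule ext)
      fix e assume e: "e \<in> E"
      have "Q *v (Q *v e) = \<bar>l e\<bar>\<^sup>2 *\<^sub>R e" using Q sq[OF e] by (simp add: matrix_vector_mul_assoc)
      then show "Q *v e = P *v e" using Q psd_matrix_eigenvector_of_square[of Q e "\<bar>l e\<bar>"] by (simp add: Pe e)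
    qed
  qed (simp add: psd PP)
  then show ?thesis using Pe \<open>e \<in> E\<close> by simp
qed

lemma trace_matrix_abs:
  fixes B :: "real ^ 'm ^ 'm::finite"
  assumes "transpose B = B" and E: "orthonormal_basis E" and "\<And>e. e \<in> E \<Longrightarrow> B *v e = l e *\<^sub>R e"
  shows "trace (matrix_abs B) = (\<Sum>e\<in>E. \<bar>l e\<bar>)"
proof -
  have "e \<bullet> e = 1" if "e \<in> E" for e using E that by (simp add: orthonormal_basis_def dot_square_norm)
  then show ?thesis
    by (simp add: trace_orthonormal_basis[OF E] matrix_abs_eigenvector[OF assms] cong: sum.cong)
qed

section \<open>Integrals over the unit sphere\<close>

lemma sets_sphere_measure [measurable_cong, simp]: "sets sphere_measure = sets borel"
  by (simp add: sphere_measure_def)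

lemma space_sphere_measure [simp]: "space sphere_measure = UNIV"
  by (simp add: sphere_measure_def)

lemma integrable_sphere_bounded:
  fixes g :: "real ^ 'm::finite \<Rightarrow> real"
  assumes [measurable]: "g \<in> borel_measurable borel" and bd: "\<And>x. norm x = 1 \<Longrightarrow> \<bar>g x\<bar> \<le> C"
  shows "integrable sphere_measure g"
proof -
  interpret prob_space "sphere_measure :: (real ^ 'm) measure" by (rule prob_space_sphere_measure)
  show ?thesis
  proof (rule integrable_const_bound[of _ C])
    show "AE x in sphere_measure. norm (g x) \<le> C"
      using AE_sphere_measure by eventually_elim (simp add: bd)
  qed measurable
qed

lemma sphere_integral_orthogonal:
  fixes g :: "real ^ 'm::finite \<Rightarrow> real" and f :: "real ^ 'm \<Rightarrow> real ^ 'm"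
  assumes f: "orthogonal_transformation f" and [measurable]: "g \<in> borel_measurable borel"
  shows "(\<integral>x. g (f x) \<partial>sphere_measure) = (\<integral>x. g x \<partial>sphere_measure)"
proof -
  have [measurable]: "f \<in> borel_measurable borel"
    using f by (intro borel_measurable_continuous_onI linear_continuous_on)
      (simp add: linear_conv_bounded_linear[symmetric] orthogonal_transformation_linear)
  have "(\<integral>x. g x \<partial>sphere_measure) = (\<integral>x. g x \<partial>distr sphere_measure borel f)"
    by (simp add: sphere_measure_orthogonal_invariant[OF f])
  also have "\<dots> = (\<integral>x. g (f x) \<partial>sphere_measure)" by (rule integral_distr) measurable
  finally show ?thesis by simp
qed

definition coord_reflection :: "'m \<Rightarrow> real ^ 'm \<Rightarrow> real ^ 'm::finite" where
  "coord_reflection i x = (\<chi> j. if j = i then - x $ j else x $ j)"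

lemma orthogonal_coord_reflection: "orthogonal_transformation (coord_reflection i)"
  unfolding orthogonal_transformation_def
  by (auto intro!: linearI sum.cong simp: coord_reflection_def vec_eq_iff inner_vec_def)

lemma orthogonal_coord_permutation:
  assumes "bij p"
  shows "orthogonal_transformation (\<lambda>x :: real ^ 'm::finite. \<chi> k. x $ p k)"
  unfolding orthogonal_transformation_def
proof (intro conjI allI)
  show "linear (\<lambda>x :: real ^ 'm. \<chi> k. x $ p k)" by (auto intro!: linearI simp: vec_eq_iff)
  fix x y :: "real ^ 'm"
  show "(\<chi> k. x $ p k) \<bullet> (\<chi> k. y $ p k) = x \<bullet> y"
    using sum.reindex_bij_betw[OF assms, of "\<lambda>k. x $ k * y $ k"] by (simp add: inner_vec_def)
qed

text \<open>
  By invariance under permutations of the coordinates all the second moments agree, and they add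
  up to \<open>1\<close>.
\<close>

lemma sphere_second_moment:
  "(\<integral>x. (x $ i)\<^sup>2 \<partial>sphere_measure) = 1 / real CARD('m)" for i :: "'m::finite"
proof -
  interpret prob_space "sphere_measure :: (real ^ 'm) measure" by (rule prob_space_sphere_measure)
  have same: "(\<integral>x. (x $ j)\<^sup>2 \<partial>sphere_measure) = (\<integral>x. (x $ i)\<^sup>2 \<partial>sphere_measure)" for j :: 'm
    using sphere_integral_orthogonal[OF orthogonal_coord_permutation[OF bij_transpose[of i j]], of "\<lambda>x. (x $ i)\<^sup>2"]
    by simp
  have int: "integrable sphere_measure (\<lambda>x. (x $ j)\<^sup>2)" for j :: 'm
  proof (rule integrable_sphere_bounded[of _ 1])
    fix x :: "real ^ 'm" assume "norm x = 1"
    then show "\<bar>(x $ j)\<^sup>2\<bar> \<le> 1" using component_le_norm_cart[of x j] by (simp add: abs_square_le_1)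
  qed measurable
  have "(\<Sum>j::'m\<in>UNIV. \<integral>x. (x $ j)\<^sup>2 \<partial>sphere_measure) = (\<Sum>j::'m\<in>UNIV. \<integral>x. (x $ i)\<^sup>2 \<partial>sphere_measure)"
    by (rule sum.cong[OF refl same])
  then have "real CARD('m) * (\<integral>x. (x $ i)\<^sup>2 \<partial>sphere_measure) = (\<Sum>j::'m\<in>UNIV. \<integral>x. (x $ j)\<^sup>2 \<partial>sphere_measure)"
    by simp
  also have "\<dots> = (\<integral>x. (\<Sum>j::'m\<in>UNIV. (x $ j)\<^sup>2) \<partial>sphere_measure)" by (simp add: int)
  also have "\<dots> = (\<integral>x. 1 \<partial>(sphere_measure :: (real ^ 'm) measure))"
  proof (rule integral_cong_AE)
    show "AE x :: real ^ 'm in sphere_measure. (\<Sum>j\<in>UNIV. (x $ j)\<^sup>2) = 1"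
      using AE_sphere_measure by eventually_elim (auto simp: norm_vec_def L2_set_def)
  qed measurable
  also have "\<dots> = 1" using prob_space by simp
  finally show ?thesis by (simp add: field_simps)
qed

text \<open>
  Both sides scale linearly with \<open>B\<close>, so this is the infimum in the definition of \<^const>\<open>vartheta\<close>
  applied to the multiple of \<open>B\<close> with \<open>tr \<bar>B\<bar> = m\<close>; the inverse of \<^const>\<open>vartheta\<close> is that infimum
  even if it is \<open>0\<close>.
\<close>

lemma sphere_quadratic_integral_ge:
  fixes B :: "real ^ 'm ^ 'm::finite"
  assumes sym: "transpose B = B" and E: "orthonormal_basis E" and eig: "\<And>e. e \<in> E \<Longrightarrow> B *v e = l e *\<^sub>R e"
  shows "1 / vartheta TYPE('m) * (\<Sum>e\<in>E. \<bar>l e\<bar>) \<le> real CARD('m) * (\<integral>\<xi>. \<bar>\<xi> \<bullet> (B *v \<xi>)\<bar> \<partial>sphere_measure)"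
proof -
  define t where "t = (\<Sum>e\<in>E. \<bar>l e\<bar>)"
  have t0: "t \<ge> 0" by (simp add: t_def sum_nonneg)
  show ?thesis
  proof (cases "t = 0")
    case False
    then have t: "t > 0" using t0 by simp
    define c where "c = real CARD('m) / t"
    have c: "c > 0" using t by (simp add: c_def)
    have "trace (matrix_abs (c *\<^sub>R B)) = (\<Sum>e\<in>E. \<bar>c * l e\<bar>)"
      by (rule trace_matrix_abs[OF _ E])
         (simp_all add: sym eig transpose_scalar scaleR_matrix_vector_assoc[symmetric])
    also have "\<dots> = real CARD('m)"
      using t c by (simp only: abs_mult sum_distrib_left[symmetric] t_def[symmetric]) (simp add: c_def)
    finally have "Inf {(\<integral>\<xi>. \<bar>\<xi> \<bullet> (B *v \<xi>)\<bar> \<partial>sphere_measure) | B :: real ^ 'm ^ 'm.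
                transpose B = B \<and> trace (matrix_abs B) = real CARD('m)}
        \<le> (\<integral>\<xi>. \<bar>\<xi> \<bullet> ((c *\<^sub>R B) *v \<xi>)\<bar> \<partial>sphere_measure)"
      by (intro cInf_lower) (auto intro!: bdd_belowI[of _ 0] simp: transpose_scalar sym)
    then have "1 / vartheta TYPE('m) \<le> c * (\<integral>\<xi>. \<bar>\<xi> \<bullet> (B *v \<xi>)\<bar> \<partial>sphere_measure)"
      using c by (simp add: vartheta_def scaleR_matrix_vector_assoc[symmetric] abs_mult)
    then show ?thesis using t by (simp add: c_def t_def[symmetric] field_simps)
  qed (simp add: t_def[symmetric])
qed

text \<open>
  The identity matrix is admissible, so the infimum is over a nonempty set of nonnegative numbers.
\<close>

lemma inverse_vartheta_nonneg: "0 \<le> 1 / vartheta TYPE('m::finite)"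
proof -
  have "trace (matrix_abs (mat 1 :: real ^ 'm ^ 'm)) = real CARD('m)"
  proof -
    have "orthonormal_basis (Basis :: (real ^ 'm) set)"
      by (auto simp: orthonormal_basis_def pairwise_def orthogonal_def inner_Basis)
    from trace_matrix_abs[OF transpose_mat this, of 1 "\<lambda>_. 1"] show ?thesis by simp
  qed
  then have "0 \<le> Inf {(\<integral>\<xi>. \<bar>\<xi> \<bullet> (B *v \<xi>)\<bar> \<partial>sphere_measure) | B :: real ^ 'm ^ 'm.
                transpose B = B \<and> trace (matrix_abs B) = real CARD('m)}"
    by (intro cInf_greatest) (auto intro: transpose_mat)
  then show ?thesis by (simp add: vartheta_def)
qed

section \<open>Rounding the sphere to finitely many points\<close>

lemma coordinatewise_odd_rounding:
  assumes "0 < \<delta>"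
  obtains h :: "real \<Rightarrow> real" where "h \<in> borel_measurable borel" "\<And>t. h (- t) = - h t"
    "\<And>t. \<bar>h t\<bar> \<le> \<bar>t\<bar>" "\<And>t. \<bar>h t - t\<bar> \<le> \<delta>" "finite (h ` {-1..1})"
proof -
  \<comment> \<open>truncation towards zero to a multiple of \<open>\<delta>\<close>: rounding down would not be odd\<close>
  define h where "h t = sgn t * (\<delta> * of_int \<lfloor>\<bar>t\<bar> / \<delta>\<rfloor>)" for t
  have fl: "0 \<le> \<delta> * of_int \<lfloor>\<bar>t\<bar> / \<delta>\<rfloor>" "\<delta> * of_int \<lfloor>\<bar>t\<bar> / \<delta>\<rfloor> \<le> \<bar>t\<bar>" "\<bar>t\<bar> \<le> \<delta> * of_int \<lfloor>\<bar>t\<bar> / \<delta>\<rfloor> + \<delta>" for t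
  proof -
    show "0 \<le> \<delta> * of_int \<lfloor>\<bar>t\<bar> / \<delta>\<rfloor>" using assms by simp
    have "of_int \<lfloor>\<bar>t\<bar> / \<delta>\<rfloor> \<le> \<bar>t\<bar> / \<delta>" by linarith
    from mult_left_mono[OF this, of \<delta>] show "\<delta> * of_int \<lfloor>\<bar>t\<bar> / \<delta>\<rfloor> \<le> \<bar>t\<bar>" using assms by simp
    have "\<bar>t\<bar> / \<delta> \<le> of_int \<lfloor>\<bar>t\<bar> / \<delta>\<rfloor> + 1" by linarith
    from mult_left_mono[OF this, of \<delta>] show "\<bar>t\<bar> \<le> \<delta> * of_int \<lfloor>\<bar>t\<bar> / \<delta>\<rfloor> + \<delta>"
      using assms by (simp add: distrib_left)
  qed
  show ?thesis
  proof (rule that[of h])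
    show "h \<in> borel_measurable borel" unfolding h_def sgn_if by measurable
    show "h (- t) = - h t" for t by (simp add: h_def sgn_minus)
    show "\<bar>h t\<bar> \<le> \<bar>t\<bar>" for t using fl[of t] by (auto simp: h_def sgn_if abs_mult)
    show "\<bar>h t - t\<bar> \<le> \<delta>" for t using fl[of t] assms by (auto simp: h_def sgn_if abs_le_iff)
    have "h ` {-1..1} \<subseteq> (\<lambda>(s, n). s * (\<delta> * of_int n)) ` ({-1, 0, 1} \<times> {0..\<lfloor>1 / \<delta>\<rfloor>})"
    proof
      fix y assume "y \<in> h ` {-1..1}"
      then obtain t where t: "t \<in> {-1..1}" "y = h t" by blast
      have "\<lfloor>\<bar>t\<bar> / \<delta>\<rfloor> \<in> {0..\<lfloor>1 / \<delta>\<rfloor>}"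
        using t assms by (simp add: floor_mono divide_right_mono abs_le_iff)
      moreover have "sgn t \<in> {-1, 0, 1}" by (simp add: sgn_if)
      ultimately show "y \<in> (\<lambda>(s, n). s * (\<delta> * of_int n)) ` ({-1, 0, 1} \<times> {0..\<lfloor>1 / \<delta>\<rfloor>})"
        unfolding t(2) h_def by (intro image_eqI[where x="(sgn t, \<lfloor>\<bar>t\<bar> / \<delta>\<rfloor>)"]) auto
    qed
    then show "finite (h ` {-1..1})" by (rule finite_subset) auto
  qed
qed


lemma square_difference_bound:
  fixes e x y :: "'a::real_inner"
  assumes "norm e = 1" "norm x \<le> 1" "norm y \<le> 1"
  shows "\<bar>(e \<bullet> x)\<^sup>2 - (e \<bullet> y)\<^sup>2\<bar> \<le> 2 * norm (x - y)"
proof -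
  have "\<bar>e \<bullet> (x - y)\<bar> \<le> norm (x - y)" "\<bar>e \<bullet> x\<bar> \<le> 1" "\<bar>e \<bullet> y\<bar> \<le> 1"
    using Cauchy_Schwarz_ineq2[of e "x - y"] Cauchy_Schwarz_ineq2[of e x] Cauchy_Schwarz_ineq2[of e y] assms by auto
  then have "\<bar>e \<bullet> x + e \<bullet> y\<bar> * \<bar>e \<bullet> (x - y)\<bar> \<le> 2 * norm (x - y)" by (intro mult_mono) auto
  moreover have "(e \<bullet> x)\<^sup>2 - (e \<bullet> y)\<^sup>2 = (e \<bullet> x + e \<bullet> y) * (e \<bullet> (x - y))"
    by (simp add: power2_eq_square inner_diff_right algebra_simps)
  ultimately show ?thesis by (simp add: abs_mult)
qed

lemma eigenbasis_quadratic_form: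
  fixes B :: "real ^ 'm ^ 'm::finite"
  assumes E: "orthonormal_basis E" and eig: "\<And>e. e \<in> E \<Longrightarrow> B *v e = l e *\<^sub>R e" and sym: "transpose B = B"
  shows "x \<bullet> (B *v x) = (\<Sum>e\<in>E. l e * (e \<bullet> x)\<^sup>2)"
proof -
  have "x \<bullet> (B *v x) = (\<Sum>e\<in>E. (e \<bullet> x) * (e \<bullet> (B *v x)))" by (rule orthonormal_basis_inner[OF E])
  also have "\<dots> = (\<Sum>e\<in>E. l e * (e \<bullet> x)\<^sup>2)"
    by (intro sum.cong) (simp_all add: symmetric_matrix_inner[OF sym] eig power2_eq_square)
  finally show ?thesis .
qed

text \<open>
  The image of the sphere measure under \<open>r\<close> is a finite sum of point masses.
\<close>

lemma sphere_integral_finite_range: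
  fixes g :: "real ^ 'm::finite \<Rightarrow> real" and r :: "real ^ 'm \<Rightarrow> real ^ 'm"
  assumes [measurable]: "r \<in> borel_measurable borel" "g \<in> borel_measurable borel" and P: "finite P" "r ` sphere 0 1 \<subseteq> P"
  shows "(\<integral>x. g (r x) \<partial>sphere_measure) = (\<Sum>p\<in>P. measure sphere_measure (r -` {p}) * g p)"
proof -
  interpret prob_space "sphere_measure :: (real ^ 'm) measure" by (rule prob_space_sphere_measure)
  have [measurable]: "r -` {p} \<in> sets borel" for p
    using measurable_sets[OF assms(1), of "{p}"] by simp
  have g: "g (r x) = (\<Sum>p\<in>P. g p * indicator (r -` {p}) x)" if "norm x = 1" for x
  proof -
    have "r x \<in> P" using that P(2) by auto
    have "(\<Sum>p\<in>P. g p * indicator (r -` {p}) x) = (\<Sum>p\<in>P. if p = r x then g p else 0)"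
      by (intro sum.cong) (auto simp: indicator_def)
    then show ?thesis using P(1) \<open>r x \<in> P\<close> by simp
  qed
  have "(\<integral>x. g (r x) \<partial>sphere_measure) = (\<integral>x. (\<Sum>p\<in>P. g p * indicator (r -` {p}) x) \<partial>sphere_measure)"
  proof (rule integral_cong_AE)
    show "AE x in sphere_measure. g (r x) = (\<Sum>p\<in>P. g p * indicator (r -` {p}) x)"
      using AE_sphere_measure by eventually_elim (simp add: g)
  qed measurable
  also have "\<dots> = (\<Sum>p\<in>P. measure sphere_measure (r -` {p}) * g p)"
    by (subst Bochner_Integration.integral_sum) (auto simp: mult.commute emeasure_eq_measure)
  finally show ?thesis .
qed

lemma finite_vectors_with_coordinates_in:
  assumes "finite S"
  shows "finite {x :: 'a ^ 'm::finite. \<forall>i. x $ i \<in> S}"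
proof -
  have "{x :: 'a ^ 'm. \<forall>i. x $ i \<in> S} \<subseteq> vec_lambda ` (UNIV \<rightarrow>\<^sub>E S)"
  proof
    fix x :: "'a ^ 'm" assume "x \<in> {x. \<forall>i. x $ i \<in> S}"
    then show "x \<in> vec_lambda ` (UNIV \<rightarrow>\<^sub>E S)"
      by (intro image_eqI[of _ _ "vec_nth x"]) auto
  qed
  moreover have "finite ((UNIV :: 'm set) \<rightarrow>\<^sub>E S)" using assms by (intro finite_PiE) auto
  ultimately show ?thesis by (meson finite_imageI finite_subset)
qed

text \<open>
  The rounding acts on each coordinate by the same odd function. As the sphere measure is invariant
  under reflections in coordinate hyperplanes, the mixed moments of the rounded vector vanish
  exactly, just as those of the original one; the diagonal moments do not increase because
  every coordinate is moved towards \<open>0\<close>.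
\<close>

lemma sphere_rounding:
  assumes "0 < \<delta>"
  obtains r :: "real ^ 'm::finite \<Rightarrow> real ^ 'm" and P where
    "r \<in> borel_measurable borel" "finite P" "r ` sphere 0 1 \<subseteq> P"
    "\<And>x. norm (r x) \<le> norm x" "\<And>x. norm (r x - x) \<le> \<delta>"
    "\<And>i j. i \<noteq> j \<Longrightarrow> (\<integral>x. r x $ i * r x $ j \<partial>sphere_measure) = 0"
    "\<And>i. (\<integral>x. (r x $ i)\<^sup>2 \<partial>sphere_measure) \<le> 1 / real CARD('m)"
proof -
  define \<eta> where "\<eta> = \<delta> / real CARD('m)"
  have "0 < \<eta>" using assms by (simp add: \<eta>_def)
  then obtain h where h [measurable]: "h \<in> borel_measurable borel" and odd: "\<And>t. h (- t) = - h t"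
    and le: "\<And>t. \<bar>h t\<bar> \<le> \<bar>t\<bar>" and near: "\<And>t. \<bar>h t - t\<bar> \<le> \<eta>" and fin: "finite (h ` {-1..1})"
    using coordinatewise_odd_rounding by blast
  define r :: "real ^ 'm \<Rightarrow> real ^ 'm" where "r x = (\<chi> i. h (x $ i))" for x
  have r_nth: "r x $ i = h (x $ i)" for x i by (simp add: r_def)
  have norm_r: "norm (r x) \<le> norm x" for x
    by (rule norm_le_componentwise_cart) (simp add: r_nth le)
  have coord: "\<bar>x $ i\<bar> \<le> 1" if "norm x = 1" for x :: "real ^ 'm" and i
    using component_le_norm_cart[of x i] that by simp
  have int: "integrable sphere_measure (\<lambda>x :: real ^ 'm. (h (x $ i))\<^sup>2)"
    "integrable sphere_measure (\<lambda>x :: real ^ 'm. (x $ i)\<^sup>2)" for i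
  proof -
    show "integrable sphere_measure (\<lambda>x :: real ^ 'm. (x $ i)\<^sup>2)"
      by (rule integrable_sphere_bounded[of _ 1]) (simp_all add: abs_square_le_1 coord)
    show "integrable sphere_measure (\<lambda>x :: real ^ 'm. (h (x $ i))\<^sup>2)"
      by (rule integrable_sphere_bounded[of _ 1])
         (measurable, simp add: abs_square_le_1 order_trans[OF le coord])
  qed
  show ?thesis
  proof (rule that[of r "{x. \<forall>i. x $ i \<in> h ` {-1..1}}"])
    show "r \<in> borel_measurable borel" 
      by (subst borel_measurable_euclidean_space) (auto simp: Basis_vec_def inner_axis r_nth)
    show "finite {x :: real ^ 'm. \<forall>i. x $ i \<in> h ` {-1..1}}"
      by (rule finite_vectors_with_coordinates_in[OF fin])
    show "r ` sphere 0 1 \<subseteq> {x. \<forall>i. x $ i \<in> h ` {-1..1}}"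
      using coord by (auto simp: r_nth abs_le_iff intro!: imageI)
    show "norm (r x) \<le> norm x" for x by (rule norm_r)
    show "norm (r x - x) \<le> \<delta>" for x
    proof -
      have "norm (r x - x) \<le> (\<Sum>i\<in>UNIV. \<bar>(r x - x) $ i\<bar>)" by (rule norm_le_l1_cart)
      also have "\<dots> \<le> (\<Sum>i\<in>(UNIV :: 'm set). \<eta>)" by (intro sum_mono) (simp add: r_nth near)
      finally show ?thesis by (simp add: \<eta>_def)
    qed
    show "(\<integral>x. r x $ i * r x $ j \<partial>sphere_measure) = 0" if "i \<noteq> j" for i j
    proof -
      have "(\<integral>x. h (coord_reflection i x $ i) * h (coord_reflection i x $ j) \<partial>sphere_measure) =
          (\<integral>x. h (x $ i) * h (x $ j) \<partial>sphere_measure)"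
        by (rule sphere_integral_orthogonal[OF orthogonal_coord_reflection]) measurable
      then show ?thesis using that by (simp add: coord_reflection_def odd r_nth)
    qed
    show "(\<integral>x. (r x $ i)\<^sup>2 \<partial>sphere_measure) \<le> 1 / real CARD('m)" for i
      unfolding sphere_second_moment[symmetric, of i] r_nth
      by (intro integral_mono int) (simp add: abs_le_square_iff[symmetric] le)
  qed
qed

text \<open>
  In an eigenbasis, \<open>x \<bullet> B x = \<Sum>e. l\<^sub>e (e \<bullet> x)\<^sup>2\<close>, and each square changes by at most \<open>2\<delta>\<close> when \<open>x\<close> is
  moved by \<open>\<delta>\<close> inside the unit ball. The error is thus controlled by \<open>tr \<bar>B\<bar>\<close>, uniformly in the
  directions of the eigenvectors.
\<close>

lemma discretised_quadratic_integral_ge: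
  fixes B :: "real ^ 'm ^ 'm::finite" and r :: "real ^ 'm \<Rightarrow> real ^ 'm"
  assumes sym: "transpose B = B" and E: "orthonormal_basis E" and eig: "\<And>e. e \<in> E \<Longrightarrow> B *v e = l e *\<^sub>R e"
    and [measurable]: "r \<in> borel_measurable borel" and r: "\<And>x. norm (r x) \<le> norm x" "\<And>x. norm (r x - x) \<le> \<delta>"
  shows "(1 / vartheta TYPE('m) - 2 * real CARD('m) * \<delta>) * (\<Sum>e\<in>E. \<bar>l e\<bar>)
    \<le> real CARD('m) * (\<integral>x. \<bar>r x \<bullet> (B *v r x)\<bar> \<partial>sphere_measure)"
proof -
  interpret prob_space "sphere_measure :: (real ^ 'm) measure" by (rule prob_space_sphere_measure)
  define L where "L = (\<Sum>e\<in>E. \<bar>l e\<bar>)"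
  have Bm [measurable]: "(*v) B \<in> borel_measurable borel"
    by (intro borel_measurable_continuous_onI matrix_vector_mult_linear_continuous_on)
  have e1: "norm e = 1" if "e \<in> E" for e using E that by (simp add: orthonormal_basis_def)
  have qf: "x \<bullet> (B *v x) = (\<Sum>e\<in>E. l e * (e \<bullet> x)\<^sup>2)" for x
    by (rule eigenbasis_quadratic_form[OF E _ sym]) (rule eig)
  have L: "\<bar>x \<bullet> (B *v x)\<bar> \<le> L" if "norm x \<le> 1" for x
  proof -
    have "\<bar>l e * (e \<bullet> x)\<^sup>2\<bar> \<le> \<bar>l e\<bar>" if "e \<in> E" for e
    proof -
      have "\<bar>e \<bullet> x\<bar> \<le> 1" using Cauchy_Schwarz_ineq2[of e x] e1[OF that] \<open>norm x \<le> 1\<close> by simp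
      then have "(e \<bullet> x)\<^sup>2 \<le> 1" by (simp add: abs_square_le_1)
      then show ?thesis by (simp add: abs_mult mult_left_le)
    qed
    then show ?thesis unfolding qf L_def by (intro order_trans[OF sum_abs] sum_mono)
  qed
  have diff: "\<bar>x \<bullet> (B *v x)\<bar> \<le> \<bar>r x \<bullet> (B *v r x)\<bar> + 2 * \<delta> * L" if "norm x = 1" for x
  proof -
    have "\<bar>x \<bullet> (B *v x) - r x \<bullet> (B *v r x)\<bar> = \<bar>\<Sum>e\<in>E. l e * ((e \<bullet> r x)\<^sup>2 - (e \<bullet> x)\<^sup>2)\<bar>"
      by (subst abs_minus_commute) (simp add: qf sum_subtractf algebra_simps)
    also have "\<dots> \<le> (\<Sum>e\<in>E. \<bar>l e\<bar> * (2 * \<delta>))"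
    proof (intro order_trans[OF sum_abs] sum_mono)
      fix e assume "e \<in> E"
      have "\<bar>(e \<bullet> r x)\<^sup>2 - (e \<bullet> x)\<^sup>2\<bar> \<le> 2 * norm (r x - x)"
        by (rule square_difference_bound) (use r(1)[of x] that e1 \<open>e \<in> E\<close> in auto)
      also have "\<dots> \<le> 2 * \<delta>" using r(2)[of x] by simp
      finally show "\<bar>l e * ((e \<bullet> r x)\<^sup>2 - (e \<bullet> x)\<^sup>2)\<bar> \<le> \<bar>l e\<bar> * (2 * \<delta>)"
        by (simp add: abs_mult mult_left_mono)
    qed
    also have "\<dots> = 2 * \<delta> * L" by (simp add: L_def sum_distrib_left mult.commute)
    finally show ?thesis by linarith
  qed
  have int: "integrable sphere_measure (\<lambda>x. \<bar>r x \<bullet> (B *v r x)\<bar>)" "integrable sphere_measure (\<lambda>x. \<bar>x \<bullet> (B *v x)\<bar>)"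
    using L order_trans[OF r(1)] by (auto intro!: integrable_sphere_bounded[of _ L])
  have "(\<integral>x. \<bar>x \<bullet> (B *v x)\<bar> \<partial>sphere_measure) \<le> (\<integral>x. \<bar>r x \<bullet> (B *v r x)\<bar> + 2 * \<delta> * L \<partial>sphere_measure)"
  proof (rule integral_mono_AE)
    show "AE x in sphere_measure. \<bar>x \<bullet> (B *v x)\<bar> \<le> \<bar>r x \<bullet> (B *v r x)\<bar> + 2 * \<delta> * L"
      using AE_sphere_measure by eventually_elim (simp add: diff)
  qed (simp_all add: int)
  also have "\<dots> = (\<integral>x. \<bar>r x \<bullet> (B *v r x)\<bar> \<partial>sphere_measure) + 2 * \<delta> * L"
    using int prob_space by simp
  finally have "real CARD('m) * (\<integral>x. \<bar>x \<bullet> (B *v x)\<bar> \<partial>sphere_measure) \<le>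
      real CARD('m) * ((\<integral>x. \<bar>r x \<bullet> (B *v r x)\<bar> \<partial>sphere_measure) + 2 * \<delta> * L)"
    by (intro mult_left_mono) auto
  moreover have "1 / vartheta TYPE('m) * L \<le> real CARD('m) * (\<integral>x. \<bar>x \<bullet> (B *v x)\<bar> \<partial>sphere_measure)"
    unfolding L_def by (rule sphere_quadratic_integral_ge[OF sym E]) (rule eig)
  ultimately show ?thesis
    unfolding L_def[symmetric] by (simp add: algebra_simps)
qed

section \<open>Finite Parseval frames and the symmetric matrices they compress to\<close>

lemma inner_matrix_eigenbasis:
  fixes A B :: "real ^ 'm ^ 'm::finite"
  assumes E: "orthonormal_basis E" and eig: "\<And>e. e \<in> E \<Longrightarrow> B *v e = l e *\<^sub>R e" and sym: "transpose B = B"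
  shows "A \<bullet> B = (\<Sum>e\<in>E. l e * (e \<bullet> (A *v e)))"
proof -
  have "B $ i $ j = B $ j $ i" for i j using sym by (metis transpose_def vec_lambda_beta)
  then have "A \<bullet> B = trace (A ** B)"
    by (simp add: inner_vec_def trace_def matrix_matrix_mult_def)
  also have "\<dots> = (\<Sum>e\<in>E. l e * (e \<bullet> (A *v e)))"
    by (simp add: trace_orthonormal_basis[OF E] eig matrix_vector_mul_assoc[symmetric] matrix_vector_mult_scaleR cong: sum.cong)
  finally show ?thesis .
qed


definition outer_square :: "real ^ 'm \<Rightarrow> real ^ 'm ^ 'm::finite" where
  "outer_square v = (\<chi> i j. v $ i * v $ j)"

lemma inner_outer_square: "W \<bullet> outer_square v = v \<bullet> (W *v v)"
  by (simp add: inner_vec_def outer_square_def matrix_vector_mult_def sum_distrib_left algebra_simps)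

text \<open>
  The frame consists of the grid points \<open>p\<close>, weighted by the probability that a random unit vector is
  rounded to \<open>p\<close>, and of multiples of the standard basis vectors that complete the second moment
  matrix \<open>diag(D)\<close>, \<open>D \<le> 1\<close>, to the identity. The index set is a disjoint sum because a basis vector
  can also be a grid point. The additional vectors can only increase the support function of the
  zonotope, so the lower bound from the grid points is enough for \<open>zonotope_membership\<close>.
\<close>

lemma parseval_frame_compressions:
  fixes s :: real
  assumes s: "0 < s" "s < 1"
  obtains K :: "(real ^ 'm + 'm::finite) set" and v :: "real ^ 'm + 'm \<Rightarrow> real ^ 'm" where "finite K"
    "(\<Sum>k\<in>K. outer_square (v k)) = mat 1"
    "\<And>A. transpose A = A \<Longrightarrow> (\<And>x. \<bar>x \<bullet> (A *v x)\<bar> \<le> x \<bullet> x) \<Longrightarrow>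
       \<exists>f. (\<forall>k. \<bar>f k\<bar> \<le> 1) \<and> (s / vartheta TYPE('m)) *\<^sub>R A = (\<Sum>k\<in>K. f k *\<^sub>R outer_square (v k))"
proof -
  define m where "m = real CARD('m)"
  define \<kappa> where "\<kappa> = 1 / vartheta TYPE('m)"
  have m: "m > 0" by (simp add: m_def)
  have \<kappa>: "\<kappa> \<ge> 0" using inverse_vartheta_nonneg by (simp add: \<kappa>_def)
  \<comment> \<open>chosen such that \<open>\<kappa> - 2 m \<delta> = s \<kappa>\<close>; if \<open>\<kappa> = 0\<close> the lower bound to be proved is \<open>0\<close>, and any mesh will do\<close>
  define \<delta> where "\<delta> = (if \<kappa> = 0 then 1 else (1 - s) * \<kappa> / (2 * m))"
  have "\<delta> > 0" using s m \<kappa> by (simp add: \<delta>_def)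
  then obtain r :: "real ^ 'm \<Rightarrow> real ^ 'm" and P where
    r [measurable]: "r \<in> borel_measurable borel" and P: "finite P" "r ` sphere 0 1 \<subseteq> P"
    and r_norm: "\<And>x. norm (r x) \<le> norm x" "\<And>x. norm (r x - x) \<le> \<delta>"
    and off: "\<And>i j. i \<noteq> j \<Longrightarrow> (\<integral>x. r x $ i * r x $ j \<partial>sphere_measure) = 0"
    and diag: "\<And>i. (\<integral>x. (r x $ i)\<^sup>2 \<partial>sphere_measure) \<le> 1 / real CARD('m)"
    using sphere_rounding by blast
  define D where "D i = m * (\<integral>x. (r x $ i)\<^sup>2 \<partial>sphere_measure)" for i
  have D: "D i \<le> 1" for i using diag[of i] m by (simp add: D_def m_def field_simps)
  define \<mu> where "\<mu> p = measure sphere_measure (r -` {p})" for p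
  define v :: "real ^ 'm + 'm \<Rightarrow> real ^ 'm" where
    "v = case_sum (\<lambda>p. sqrt (m * \<mu> p) *\<^sub>R p) (\<lambda>i. sqrt (1 - D i) *\<^sub>R axis i 1)"
  define K :: "(real ^ 'm + 'm) set" where "K = P <+> UNIV"
  have K: "finite K" using P by (simp add: K_def)
  have \<mu>0: "\<mu> p \<ge> 0" for p by (simp add: \<mu>_def)
  have sumK: "(\<Sum>k\<in>K. g (v k)) = (\<Sum>p\<in>P. g (sqrt (m * \<mu> p) *\<^sub>R p)) + (\<Sum>i\<in>UNIV. g (sqrt (1 - D i) *\<^sub>R axis i 1))"
    for g :: "real ^ 'm \<Rightarrow> real"
    unfolding K_def using P(1) by (simp add: sum.Plus v_def comp_def)
  have int: "(\<Sum>p\<in>P. \<mu> p * g p) = (\<integral>x. g (r x) \<partial>sphere_measure)" if "g \<in> borel_measurable borel" for g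
    unfolding \<mu>_def by (rule sphere_integral_finite_range[symmetric, OF r that P])
  have moment: "m * (\<Sum>p\<in>P. \<mu> p * (p $ i * p $ j)) = (if i = j then D i else 0)" for i j
    using off[of i j] by (subst int) (auto simp: D_def power2_eq_square)
  have frame: "(\<Sum>k\<in>K. outer_square (v k)) = mat 1"
  proof -
    have "(\<Sum>k\<in>K. v k $ i * v k $ j) = (if i = j then 1 else 0)" for i j
    proof -
      have sc: "(q * a) * (q * b) = (q * q) * (a * b)" for q a b :: real by (simp add: mult_ac)
      have "(\<Sum>p\<in>P. (sqrt (m * \<mu> p) *\<^sub>R p) $ i * (sqrt (m * \<mu> p) *\<^sub>R p) $ j) = (if i = j then D i else 0)"
        unfolding moment[symmetric] sum_distrib_left vector_scaleR_component real_scaleR_def sc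
        using m \<mu>0 by (intro sum.cong refl) (simp add: mult.assoc)
      moreover have "(\<Sum>l\<in>UNIV. (sqrt (1 - D l) *\<^sub>R axis l 1) $ i * (sqrt (1 - D l) *\<^sub>R axis l 1) $ j)
          = (\<Sum>l\<in>UNIV. if l = i then (if i = j then 1 - D i else 0) else 0)"
        unfolding vector_scaleR_component real_scaleR_def sc
        using D by (intro sum.cong refl) (auto simp: axis_def)
      ultimately show ?thesis unfolding sumK[of "\<lambda>w. w $ i * w $ j"] by simp
    qed
    then show ?thesis by (simp add: vec_eq_iff mat_def outer_square_def)
  qed
  have lower: "s * \<kappa> * (\<Sum>e\<in>E. \<bar>l e\<bar>) \<le> (\<Sum>k\<in>K. \<bar>v k \<bullet> (B *v v k)\<bar>)"
    if "transpose B = B" "orthonormal_basis E" "\<And>e. e \<in> E \<Longrightarrow> B *v e = l e *\<^sub>R e" for B l and E :: "(real ^ 'm) set"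
  proof -
    have Bm [measurable]: "(*v) B \<in> borel_measurable borel"
      by (intro borel_measurable_continuous_onI matrix_vector_mult_linear_continuous_on)
    have "s * \<kappa> * (\<Sum>e\<in>E. \<bar>l e\<bar>) \<le> max 0 (\<kappa> - 2 * m * \<delta>) * (\<Sum>e\<in>E. \<bar>l e\<bar>)"
    proof (intro mult_right_mono sum_nonneg)
      show "s * \<kappa> \<le> max 0 (\<kappa> - 2 * m * \<delta>)"
      proof (cases "\<kappa> = 0")
        case False
        then have "2 * m * \<delta> = (1 - s) * \<kappa>" using m by (simp add: \<delta>_def)
        then show ?thesis by (simp add: algebra_simps)
      qed simp
    qed simp
    also have "\<dots> \<le> m * (\<integral>x. \<bar>r x \<bullet> (B *v r x)\<bar> \<partial>sphere_measure)"
    proof -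
      have "(\<kappa> - 2 * m * \<delta>) * (\<Sum>e\<in>E. \<bar>l e\<bar>) \<le> m * (\<integral>x. \<bar>r x \<bullet> (B *v r x)\<bar> \<partial>sphere_measure)"
        unfolding \<kappa>_def m_def
        by (rule discretised_quadratic_integral_ge[OF that(1,2) _ r r_norm]) (rule that(3))
      moreover have "0 \<le> m * (\<integral>x. \<bar>r x \<bullet> (B *v r x)\<bar> \<partial>sphere_measure)" using m by simp
      ultimately show ?thesis by (simp add: max_def)
    qed
    also have "\<dots> = (\<Sum>p\<in>P. m * \<mu> p * \<bar>p \<bullet> (B *v p)\<bar>)"
      by (subst int[symmetric]) (simp_all add: sum_distrib_left mult_ac)
    also have "\<dots> = (\<Sum>p\<in>P. \<bar>(sqrt (m * \<mu> p) *\<^sub>R p) \<bullet> (B *v (sqrt (m * \<mu> p) *\<^sub>R p))\<bar>)"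
    proof (rule sum.cong[OF refl])
      fix p
      have "\<bar>(sqrt (m * \<mu> p) *\<^sub>R p) \<bullet> (B *v (sqrt (m * \<mu> p) *\<^sub>R p))\<bar> = \<bar>(sqrt (m * \<mu> p))\<^sup>2 * (p \<bullet> (B *v p))\<bar>"
        by (simp only: matrix_vector_mult_scaleR inner_scaleR_left inner_scaleR_right power2_eq_square mult.assoc)
      then show "m * \<mu> p * \<bar>p \<bullet> (B *v p)\<bar> = \<bar>(sqrt (m * \<mu> p) *\<^sub>R p) \<bullet> (B *v (sqrt (m * \<mu> p) *\<^sub>R p))\<bar>"
        using m \<mu>0 by (simp add: abs_mult)
    qed
    also have "\<dots> \<le> (\<Sum>k\<in>K. \<bar>v k \<bullet> (B *v v k)\<bar>)"
      unfolding sumK[of "\<lambda>w. \<bar>w \<bullet> (B *v w)\<bar>"] by (simp add: sum_nonneg)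
    finally show ?thesis .
  qed
  show ?thesis
  proof (rule that[OF K frame])
    fix A :: "real ^ 'm ^ 'm"
    assume A: "transpose A = A" "\<And>x. \<bar>x \<bullet> (A *v x)\<bar> \<le> x \<bullet> x"
    show "\<exists>f. (\<forall>k. \<bar>f k\<bar> \<le> 1) \<and> (s / vartheta TYPE('m)) *\<^sub>R A = (\<Sum>k\<in>K. f k *\<^sub>R outer_square (v k))"
    proof (rule zonotope_membership[OF K])
      fix W :: "real ^ 'm ^ 'm"
      \<comment> \<open>only the symmetric part of a functional is seen by symmetric matrices\<close>
      define B where "B = (1/2) *\<^sub>R (W + transpose W)"
      have Bsym: "transpose B = B" by (simp add: B_def transpose_def vec_eq_iff)
      have BA: "W \<bullet> M = M \<bullet> B" if "transpose M = M" for M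
      proof -
        have "transpose W \<bullet> M = W \<bullet> transpose M"
          unfolding inner_vec_def transpose_def by (simp, subst sum.swap, simp)
        then show ?thesis using that by (simp add: B_def inner_add_left inner_commute[of M])
      qed
      obtain E where E: "orthonormal_basis E" and eig: "\<And>e. e \<in> E \<Longrightarrow> B *v e = (e \<bullet> (B *v e)) *\<^sub>R e"
        using symmetric_matrix_eigenbasis[OF Bsym] by blast
      have "A \<bullet> B = (\<Sum>e\<in>E. (e \<bullet> (B *v e)) * (e \<bullet> (A *v e)))"
        by (rule inner_matrix_eigenbasis[OF E _ Bsym]) (rule eig)
      also have "\<dots> \<le> (\<Sum>e\<in>E. \<bar>e \<bullet> (B *v e)\<bar>)"
      proof (rule sum_mono)
        fix e assume "e \<in> E"
        then have "\<bar>e \<bullet> (A *v e)\<bar> \<le> 1" using A(2)[of e] E by (simp add: orthonormal_basis_def dot_square_norm)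
        then have "\<bar>(e \<bullet> (B *v e)) * (e \<bullet> (A *v e))\<bar> \<le> \<bar>e \<bullet> (B *v e)\<bar>"
          by (simp add: abs_mult mult_left_le)
        then show "(e \<bullet> (B *v e)) * (e \<bullet> (A *v e)) \<le> \<bar>e \<bullet> (B *v e)\<bar>" by linarith
      qed
      finally have "s * \<kappa> * (A \<bullet> B) \<le> s * \<kappa> * (\<Sum>e\<in>E. \<bar>e \<bullet> (B *v e)\<bar>)"
        using s \<kappa> by (intro mult_left_mono) auto
      also have "\<dots> \<le> (\<Sum>k\<in>K. \<bar>v k \<bullet> (B *v v k)\<bar>)"
        by (rule lower[OF Bsym E]) (rule eig)
      also have "\<dots> = (\<Sum>k\<in>K. \<bar>W \<bullet> outer_square (v k)\<bar>)"
      proof (intro sum.cong refl)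
        fix k
        have "transpose (outer_square (v k)) = outer_square (v k)"
          by (simp add: outer_square_def transpose_def vec_eq_iff mult.commute)
        from BA[OF this] show "\<bar>v k \<bullet> (B *v v k)\<bar> = \<bar>W \<bullet> outer_square (v k)\<bar>"
          by (simp add: inner_outer_square[symmetric] inner_commute)
      qed
      finally show "W \<bullet> ((s / vartheta TYPE('m)) *\<^sub>R A) \<le> (\<Sum>k\<in>K. \<bar>W \<bullet> outer_square (v k)\<bar>)"
        using BA[OF A(1)] by (simp add: \<kappa>_def)
    qed
  qed
qed

section \<open>Diagonal operators on a finite-dimensional Hilbert space\<close>

text \<open>
  Two candidates for the adjoint have the same inner products with every vector, so the inner
  product of their difference with itself vanishes.
\<close>

lemma adjoint_operator_eqI:
  assumes H: "complex_hilbert_space H" and x: "x \<in> carrier H"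
    and adj: "\<And>z. z \<in> carrier H \<Longrightarrow> hinner K (T z) y = hinner H z x"
  shows "adjoint_operator H K T y = x"
  unfolding adjoint_operator_def
proof (rule the_equality)
  interpret H: complex_hilbert_space H by (rule H)
  fix x' assume x': "x' \<in> carrier H \<and> (\<forall>z\<in>carrier H. hinner K (T z) y = hinner H z x')"
  define w where "w = x' \<oplus>\<^bsub>H\<^esub> ((-1) \<odot>\<^bsub>H\<^esub> x)"
  have mx: "(-1) \<odot>\<^bsub>H\<^esub> x \<in> carrier H"
    by (rule H.smult_closed) (simp_all add: x complex_field_def)
  then have w: "w \<in> carrier H" using x' by (simp add: w_def)
  have "hinner H w w = hinner H x' w - hinner H x w"
    using H.hinner_add_left[of x' "(-1) \<odot>\<^bsub>H\<^esub> x" w] H.hinner_smult_left[of x w "-1"] mx w x x'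
    by (simp add: w_def[symmetric])
  also have "\<dots> = cnj (hinner H w x') - cnj (hinner H w x)"
    using H.hinner_commute[of w x'] H.hinner_commute[of w x] x x' w by simp
  also have "\<dots> = 0" using adj[OF w] x' w by simp
  finally have w0: "w = \<zero>\<^bsub>H\<^esub>" using H.hinner_definite w by blast
  have "(-1) \<odot>\<^bsub>H\<^esub> x \<oplus>\<^bsub>H\<^esub> x = (-1) \<odot>\<^bsub>H\<^esub> x \<oplus>\<^bsub>H\<^esub> 1 \<odot>\<^bsub>H\<^esub> x"
    using H.smult_one[OF x] by (simp add: complex_field_def)
  also have "\<dots> = ((-1) \<oplus>\<^bsub>complex_field\<^esub> 1) \<odot>\<^bsub>H\<^esub> x"
    by (rule H.smult_l_distr[symmetric]) (simp_all add: x complex_field_def)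
  also have "\<dots> = \<zero>\<^bsub>H\<^esub>" using H.smult_l_null[OF x] by (simp add: complex_field_def)
  finally have "\<ominus>\<^bsub>H\<^esub> x = (-1) \<odot>\<^bsub>H\<^esub> x" using x mx by (intro H.minus_equality) auto
  then show "x' = x" using w0 x x' unfolding w_def
    by (metis H.minus_minus H.minus_equality H.a_inv_closed)
qed (use x adj in auto)

text \<open>
  This is \<open>\<complex>\<^sup>n\<close>, encoded as the sequences that vanish from index \<open>n\<close> on so that the dimension can be a
  number computed in a proof.
\<close>

definition finite_sequence_space :: "nat \<Rightarrow> (nat \<Rightarrow> complex) hilbert" where
  "finite_sequence_space n =
     \<lparr>carrier = {x. \<forall>k\<ge>n. x k = 0}, mult = (\<lambda>x y k. x k * y k), one = (\<lambda>_. 1), zero = (\<lambda>_. 0),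
      add = (\<lambda>x y k. x k + y k), smult = (\<lambda>c x k. c * x k), hinner = (\<lambda>x y. \<Sum>k<n. x k * cnj (y k))\<rparr>"

lemma finite_sequence_space_simps [simp]:
  "carrier (finite_sequence_space n) = {x. \<forall>k\<ge>n. x k = 0}"
  "zero (finite_sequence_space n) = (\<lambda>_. 0)"
  "add (finite_sequence_space n) x y = (\<lambda>k. x k + y k)"
  "smult (finite_sequence_space n) c x = (\<lambda>k. c * x k)"
  "hinner (finite_sequence_space n) x y = (\<Sum>k<n. x k * cnj (y k))"
  by (simp_all add: finite_sequence_space_def)

lemma hnorm_finite_sequence_space:
  "hnorm (finite_sequence_space n) x = L2_set (\<lambda>k. norm (x k)) {..<n}"
  by (simp add: hnorm_def L2_set_def complex_norm_square[symmetric] flip: of_real_power of_real_sum)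

lemma complex_hilbert_space_finite_sequence_space:
  "complex_hilbert_space (finite_sequence_space n)"
proof -
  let ?H = "finite_sequence_space n"
  have "abelian_group ?H"
  proof (rule abelian_groupI)
    fix x assume "x \<in> carrier ?H"
    then show "\<exists>y\<in>carrier ?H. y \<oplus>\<^bsub>?H\<^esub> x = \<zero>\<^bsub>?H\<^esub>"
      by (intro bexI[of _ "\<lambda>k. - x k"]) auto
  qed (auto simp: algebra_simps)
  then have mod: "Module.module complex_field ?H"
    using cring_complex_field by (intro Module.moduleI) (auto simp: complex_field_def algebra_simps)
  interpret H: Module.module complex_field ?H by fact
  have minus: "x \<ominus>\<^bsub>?H\<^esub> y = (\<lambda>k. x k - y k)" if "y \<in> carrier ?H" for x y
  proof -
    have "\<ominus>\<^bsub>?H\<^esub> y = (\<lambda>k. - y k)"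
      by (rule H.minus_equality) (use that in auto)
    then show ?thesis by (simp add: a_minus_def)
  qed
  show ?thesis
  proof (unfold_locales, goal_cases)
    case (3 x y)
    then show ?case by (simp add: mult.commute)
  next
    case (4 x)
    have "sqrt (Re (hinner ?H x x)) \<ge> 0"
      by (simp only: hnorm_def[symmetric] hnorm_finite_sequence_space L2_set_nonneg)
    then show ?case by (simp only: real_sqrt_ge_0_iff)
  next
    case (5 x)
    have "L2_set (\<lambda>k. norm (x k)) {..<n} = 0"
      by (simp only: hnorm_finite_sequence_space[symmetric] hnorm_def 5) simp
    then have "x k = 0" for k using 5(1) by (cases "k < n") (auto simp: L2_set_eq_0_iff)
    then show ?case by auto
  next
    case (6 s)
    have "\<exists>l. (\<lambda>i. s i k) \<longlonglongrightarrow> l" for k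
    proof (cases "k < n")
      case True
      have "Cauchy (\<lambda>i. s i k)"
        unfolding Cauchy_iff
      proof (intro allI impI)
        fix e :: real assume "0 < e"
        then obtain M where M: "\<forall>a\<ge>M. \<forall>b\<ge>M. hnorm ?H (s a \<ominus>\<^bsub>?H\<^esub> s b) < e" using 6(2) by blast
        have "norm (s a k - s b k) \<le> hnorm ?H (s a \<ominus>\<^bsub>?H\<^esub> s b)" for a b
          unfolding minus[OF 6(1)] hnorm_finite_sequence_space
          by (rule member_le_L2_set[of "{..<n}" k "\<lambda>k. norm (s a k - s b k)"]) (use True in auto)
        then show "\<exists>M. \<forall>a\<ge>M. \<forall>b\<ge>M. norm (s a k - s b k) < e"
          using M by (meson le_less_trans)
      qed
      then show ?thesis using Cauchy_convergent convergent_def by blast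
    next
      case False
      then have "(\<lambda>i. s i k) = (\<lambda>_. 0)" using 6(1) by auto
      then show ?thesis by auto
    qed
    then obtain l where l: "\<And>k. (\<lambda>i. s i k) \<longlonglongrightarrow> l k" by metis
    have lH: "l \<in> carrier ?H"
    proof -
      have "l k = 0" if "n \<le> k" for k
        using l[of k] 6(1) that by (simp add: LIMSEQ_const_iff)
      then show ?thesis by simp
    qed
    have "(\<lambda>i. L2_set (\<lambda>k. norm (s i k - l k)) {..<n}) \<longlonglongrightarrow> L2_set (\<lambda>k. norm (l k - l k)) {..<n}"
      unfolding L2_set_def by (intro tendsto_intros l)
    then have "(\<lambda>i. hnorm ?H (s i \<ominus>\<^bsub>?H\<^esub> l)) \<longlonglongrightarrow> 0"
      by (simp add: minus[OF lH] hnorm_finite_sequence_space L2_set_def)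
    then show ?case using lH by blast
  qed (simp_all add: algebra_simps sum.distrib sum_distrib_left)
qed

definition diagonal_operator :: "(nat \<Rightarrow> complex) \<Rightarrow> (nat \<Rightarrow> complex) \<Rightarrow> nat \<Rightarrow> complex" where
  "diagonal_operator F x = (\<lambda>k. F k * x k)"

lemma linear_operator_diagonal:
  "linear_operator (finite_sequence_space n) (finite_sequence_space n) (diagonal_operator F)"
  by (auto simp: linear_operator_def diagonal_operator_def algebra_simps)

lemma hnorm_diagonal_operator_le:
  assumes "\<And>k. norm (F k) \<le> 1"
  shows "hnorm (finite_sequence_space n) (diagonal_operator F x) \<le> hnorm (finite_sequence_space n) x"
  unfolding hnorm_finite_sequence_space diagonal_operator_def
  by (rule L2_set_mono) (simp_all add: norm_mult mult_left_le_one_le assms)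

lemma contraction_diagonal_operator:
  assumes "\<And>k. norm (F k) \<le> 1"
  shows "contraction (finite_sequence_space n) (finite_sequence_space n) (diagonal_operator F)"
proof -
  let ?H = "finite_sequence_space n"
  note le = hnorm_diagonal_operator_le[where F=F and n=n, OF assms]
  have nn: "0 \<le> hnorm ?H x" for x by (simp add: hnorm_finite_sequence_space L2_set_nonneg)
  have "bounded_operator ?H ?H (diagonal_operator F)"
    unfolding bounded_operator_def using le by (auto intro: linear_operator_diagonal exI[of _ 1])
  moreover have "operator_norm ?H ?H (diagonal_operator F) \<le> 1"
    unfolding operator_norm_def
  proof (rule cSUP_least)
    show "carrier ?H \<noteq> {}" by (auto intro: exI[of _ "\<lambda>_. 0"])
    show "hnorm ?H (diagonal_operator F x) / hnorm ?H x \<le> 1" for x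
      using le[of x] nn[of x] by (cases "hnorm ?H x = 0") (auto simp: divide_le_eq_1 less_le)
  qed
  ultimately show ?thesis by (simp add: contraction_def)
qed

lemma adjoint_diagonal_operator:
  assumes "y \<in> carrier (finite_sequence_space n)"
  shows "adjoint_operator (finite_sequence_space n) (finite_sequence_space n) (diagonal_operator F) y
    = diagonal_operator (\<lambda>k. cnj (F k)) y"
  by (rule adjoint_operator_eqI[OF complex_hilbert_space_finite_sequence_space])
     (use assms in \<open>auto simp: diagonal_operator_def mult_ac\<close>)

lemma normal_diagonal_operator:
  assumes "\<And>k. norm (F k) \<le> 1"
  shows "normal_operator (finite_sequence_space n) (diagonal_operator F)"
  using contraction_diagonal_operator[where F=F, OF assms, of n]
  by (auto simp: normal_operator_def contraction_def adjoint_diagonal_operator[simplified] diagonal_operator_def mult_ac)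

section \<open>Complex matrices, their Hermitian parts and their real forms\<close>

definition hermitian_part :: "complex ^ 'd ^ 'd::finite \<Rightarrow> complex ^ 'd ^ 'd" where
  "hermitian_part X = (\<chi> i j. (X $ i $ j + cnj (X $ j $ i)) / 2)"

text \<open>
  The left summand of the index type carries the real parts, the right one the imaginary parts;
  \<open>realify_matrix A\<close> below is the block matrix \<open>(P, -Q; Q, P)\<close> of the complex linear map
  \<open>A = P + iQ\<close> in these coordinates.
\<close>

definition complexify :: "real ^ ('d + 'd) \<Rightarrow> complex ^ 'd::finite" where
  "complexify x = (\<chi> j. Complex (x $ Inl j) (x $ Inr j))"

definition realify_matrix :: "complex ^ 'd ^ 'd::finite \<Rightarrow> real ^ ('d + 'd) ^ ('d + 'd)" where
  "realify_matrix A = (\<chi> a b. case a of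
      Inl i \<Rightarrow> (case b of Inl j \<Rightarrow> Re (A $ i $ j) | Inr j \<Rightarrow> - Im (A $ i $ j))
    | Inr i \<Rightarrow> (case b of Inl j \<Rightarrow> Im (A $ i $ j) | Inr j \<Rightarrow> Re (A $ i $ j)))"

lemma sum_UNIV_sum_type:
  "(\<Sum>a\<in>(UNIV :: ('d::finite + 'd) set). g a) = (\<Sum>i\<in>UNIV. g (Inl i)) + (\<Sum>i\<in>UNIV. g (Inr i) :: 'b::comm_monoid_add)"
  unfolding UNIV_Plus_UNIV[symmetric] by (subst sum.Plus) (simp_all add: comp_def)

lemma inner_complexify: "complexify x \<bullet> complexify y = x \<bullet> y"
  by (simp add: inner_vec_def sum_UNIV_sum_type complexify_def inner_complex_def sum.distrib)

lemma complexify_realify_matrix: "complexify (realify_matrix A *v x) = A *v complexify x"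
  by (simp add: vec_eq_iff complexify_def realify_matrix_def matrix_vector_mult_def sum_UNIV_sum_type
      complex_eq_iff sum.distrib[symmetric] sum_subtractf sum_negf algebra_simps)

lemma transpose_realify_hermitian_part: 
  "transpose (realify_matrix (hermitian_part X)) = realify_matrix (hermitian_part X)"
  by (auto simp: transpose_def realify_matrix_def hermitian_part_def vec_eq_iff field_simps split: sum.splits)

text \<open>
  The inner product here is the real one, the real part of \<open>z\<^sup>* X z\<close>, and replacing \<open>X\<close> by \<open>X\<^sup>*\<close>
  conjugates \<open>z\<^sup>* X z\<close>.
\<close>

lemma inner_hermitian_part: "z \<bullet> (hermitian_part X *v z) = z \<bullet> (X *v z)"
proof -
  have ex: "z \<bullet> (Y *v z) = Re (\<Sum>i\<in>UNIV. \<Sum>j\<in>UNIV. cnj (z $ i) * Y $ i $ j * z $ j)" for Y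
  proof -
    have dot: "a \<bullet> b = Re (cnj a * b)" for a b :: complex by (simp add: inner_complex_def)
    have "(\<Sum>i\<in>UNIV. \<Sum>j\<in>UNIV. cnj (z $ i) * Y $ i $ j * z $ j) = (\<Sum>i\<in>UNIV. cnj (z $ i) * (Y *v z) $ i)"
      by (simp add: matrix_vector_mult_def sum_distrib_left mult.assoc)
    then show ?thesis by (simp only: inner_vec_def dot Re_sum)
  qed
  define S where "S = (\<Sum>i\<in>UNIV. \<Sum>j\<in>UNIV. cnj (z $ i) * X $ i $ j * z $ j)"
  have "(\<Sum>i\<in>UNIV. \<Sum>j\<in>UNIV. cnj (z $ i) * cnj (X $ j $ i) * z $ j) = cnj S"
    unfolding S_def by (subst sum.swap) (simp add: mult_ac)
  moreover have "(\<Sum>i\<in>UNIV. \<Sum>j\<in>UNIV. cnj (z $ i) * hermitian_part X $ i $ j * z $ j) =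
     (S + (\<Sum>i\<in>UNIV. \<Sum>j\<in>UNIV. cnj (z $ i) * cnj (X $ j $ i) * z $ j)) / 2"
    unfolding S_def
    by (simp add: hermitian_part_def sum.distrib[symmetric] sum_divide_distrib[symmetric] add_divide_distrib[symmetric] algebra_simps)
  ultimately have eq: "(\<Sum>i\<in>UNIV. \<Sum>j\<in>UNIV. cnj (z $ i) * hermitian_part X $ i $ j * z $ j) = (S + cnj S) / 2"
    by (simp only:)
  show ?thesis unfolding ex eq S_def[symmetric] by simp
qed

lemma realify_hermitian_part_bound:
  fixes X :: "complex ^ 'd ^ 'd::finite"
  assumes "\<And>z. norm (X *v z) \<le> norm z" and "norm e = 1"
  shows "\<bar>x \<bullet> (realify_matrix (hermitian_part (\<chi> i j. e * X $ i $ j)) *v x)\<bar> \<le> x \<bullet> x"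
proof -
  let ?Y = "\<chi> i j. e * X $ i $ j"
  define z where "z = complexify x"
  have "?Y *v z = (\<chi> i. e * (X *v z) $ i)"
    by (simp add: vec_eq_iff matrix_vector_mult_def sum_distrib_left mult.assoc)
  then have "norm (?Y *v z) = norm (X *v z)"
    by (simp add: norm_vec_def norm_mult assms(2))
  then have "norm (?Y *v z) \<le> norm z" using assms(1) by simp
  then have "\<bar>z \<bullet> (?Y *v z)\<bar> \<le> norm z * norm z"
    using Cauchy_Schwarz_ineq2[of z "?Y *v z"] by (meson mult_left_mono norm_ge_zero order_trans)
  also have "\<dots> = x \<bullet> x"
    using inner_complexify[of x x] by (simp add: z_def power2_norm_eq_inner[symmetric] power2_eq_square)
  also have "z \<bullet> (?Y *v z) = x \<bullet> (realify_matrix (hermitian_part ?Y) *v x)"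
    by (simp add: z_def inner_complexify[symmetric, of x] complexify_realify_matrix inner_hermitian_part)
  finally show ?thesis .
qed

text \<open>
  The terms with \<open>X\<^sup>*\<close> have the coefficients \<open>1\<close>, \<open>(cnj \<omega>)\<^sup>2\<close>, \<open>\<omega>\<^sup>2\<close>, which add up to \<open>0\<close>.
\<close>

lemma cube_root_combination:
  fixes X :: "complex ^ 'd ^ 'd::finite" and \<omega> :: complex
  assumes "\<omega> = Complex (-1/2) (sqrt 3 / 2)"
  shows "X $ i $ j = 2 / 3 * (hermitian_part X $ i $ j + cnj \<omega> * hermitian_part (\<chi> i j. \<omega> * X $ i $ j) $ i $ j
     + \<omega> * hermitian_part (\<chi> i j. cnj \<omega> * X $ i $ j) $ i $ j)"
proof -
  have w: "\<omega> * cnj \<omega> = 1" "1 + \<omega> * \<omega> + cnj \<omega> * cnj \<omega> = 0"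
    by (simp_all add: assms complex_eq_iff field_simps)
  have "2 / 3 * (hermitian_part X $ i $ j + cnj \<omega> * hermitian_part (\<chi> i j. \<omega> * X $ i $ j) $ i $ j
     + \<omega> * hermitian_part (\<chi> i j. cnj \<omega> * X $ i $ j) $ i $ j)
    = ((1 + 2 * (\<omega> * cnj \<omega>)) * X $ i $ j + (1 + \<omega> * \<omega> + cnj \<omega> * cnj \<omega>) * cnj (X $ j $ i)) / 3"
    by (simp add: hermitian_part_def field_simps)
  then show ?thesis by (simp add: w)
qed

text \<open>
  The squared norm is \<open>a\<^sup>2 + b\<^sup>2 + c\<^sup>2 - ab - bc - ca\<close>, which is the square of the difference of the
  largest and the smallest of the three numbers minus the product of the two gaps.
\<close>

lemma cube_root_norm_bound:
  fixes a b c :: real and \<omega> :: complex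
  assumes "\<bar>a\<bar> \<le> 1" "\<bar>b\<bar> \<le> 1" "\<bar>c\<bar> \<le> 1" and w: "\<omega> = Complex (-1/2) (sqrt 3 / 2)"
  shows "norm (a + cnj \<omega> * b + \<omega> * c) \<le> 2"
proof -
  have key: "(x - y)\<^sup>2 - (z - y) * (x - z) \<le> 4" if "0 \<le> (z - y) * (x - z)" "\<bar>x\<bar> \<le> 1" "\<bar>y\<bar> \<le> 1" for x y z :: real
  proof -
    have "(x - y)\<^sup>2 \<le> 2\<^sup>2" using that by (subst abs_le_square_iff[symmetric]) auto
    then show ?thesis using that by simp
  qed
  \<comment> \<open>one of the three numbers lies between the other two\<close>
  have "0 \<le> (b - a) * (c - b) \<or> 0 \<le> (a - b) * (c - a) \<or> 0 \<le> (c - a) * (b - c)"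
    by (auto simp: zero_le_mult_iff)
  then have "a\<^sup>2 + b\<^sup>2 + c\<^sup>2 - a * b - b * c - c * a \<le> 4"
    using key[where x=c and y=a and z=b] key[where x=c and y=b and z=a] key[where x=b and y=a and z=c] assms
    by (auto simp: power2_eq_square algebra_simps)
  moreover have "(norm (a + cnj \<omega> * b + \<omega> * c))\<^sup>2 = a\<^sup>2 + b\<^sup>2 + c\<^sup>2 - a * b - b * c - c * a"
  proof -
    have ri: "Re (a + cnj \<omega> * b + \<omega> * c) = a - b / 2 - c / 2" "Im (a + cnj \<omega> * b + \<omega> * c) = sqrt 3 * ((c - b) / 2)"
      by (simp_all add: w algebra_simps)
    show ?thesis
      unfolding cmod_power2 ri by (simp add: power_mult_distrib power2_eq_square field_simps)
  qed
  ultimately have "(norm (a + cnj \<omega> * b + \<omega> * c))\<^sup>2 \<le> 2\<^sup>2" by simp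
  then show ?thesis by (rule power2_le_imp_le) simp
qed


text \<open>
  Entrywise, \<open>z z\<^sup>*\<close> adds up the two diagonal blocks of \<open>u u\<^sup>T\<close> and the difference of the off-diagonal
  ones. A real form \<open>(P, -Q; Q, P)\<close> contains each of \<open>P\<close> and \<open>Q\<close> twice, whence the factor \<open>2\<close>.
\<close>

lemma sum_complexified_outer_squares:
  assumes "(\<Sum>k\<in>K. f k *\<^sub>R outer_square (u k)) = c *\<^sub>R realify_matrix A"
  shows "(\<Sum>k\<in>K. of_real (f k) * (complexify (u k) $ i * cnj (complexify (u k) $ j))) = 2 * of_real c * A $ i $ j"
proof -
  have ent: "(\<Sum>k\<in>K. f k * (u k $ a * u k $ b)) = c * realify_matrix A $ a $ b" for a b
    using arg_cong[OF assms, of "\<lambda>M. M $ a $ b"] by (simp add: outer_square_def)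
  have "Re (\<Sum>k\<in>K. of_real (f k) * (complexify (u k) $ i * cnj (complexify (u k) $ j)))
      = (\<Sum>k\<in>K. f k * (u k $ Inl i * u k $ Inl j)) + (\<Sum>k\<in>K. f k * (u k $ Inr i * u k $ Inr j))"
    by (simp add: complexify_def sum.distrib[symmetric] algebra_simps)
  moreover have "Im (\<Sum>k\<in>K. of_real (f k) * (complexify (u k) $ i * cnj (complexify (u k) $ j)))
      = (\<Sum>k\<in>K. f k * (u k $ Inr i * u k $ Inl j)) - (\<Sum>k\<in>K. f k * (u k $ Inl i * u k $ Inr j))"
    by (simp add: complexify_def sum_subtractf[symmetric] algebra_simps)
  ultimately show ?thesis
    unfolding ent by (simp add: complex_eq_iff realify_matrix_def)
qed

lemma realify_matrix_mat_1: "realify_matrix (mat 1) = mat 1"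
  by (auto simp: realify_matrix_def mat_def vec_eq_iff split: sum.splits)

section \<open>The isometry given by a frame\<close>

text \<open>
  The normalisation \<open>1/\<surd>2\<close> reflects that a Parseval frame of \<open>\<real>\<^sup>2\<^sup>d\<close>, read in \<open>\<complex>\<^sup>d\<close>, satisfies
  \<open>\<Sum>k. z\<^sub>k z\<^sub>k\<^sup>* = 2\<close>.
\<close>

definition frame_analysis :: "nat \<Rightarrow> (nat \<Rightarrow> complex ^ 'd::finite) \<Rightarrow> complex ^ 'd \<Rightarrow> nat \<Rightarrow> complex" where
  "frame_analysis n z w = (\<lambda>k. if k < n then (\<Sum>j\<in>UNIV. w $ j * cnj (z k $ j)) / sqrt 2 else 0)"

lemma complex_euclidean_simps [simp]:
  "carrier complex_euclidean = UNIV"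
  "add complex_euclidean x y = x + y"
  "smult complex_euclidean c x = c *s x"
  "hinner complex_euclidean x y = (\<Sum>i\<in>UNIV. x $ i * cnj (y $ i))"
  by (simp_all add: complex_euclidean_def)

lemma hinner_frame_analysis:
  "hinner (finite_sequence_space n) (frame_analysis n z w) y
    = hinner complex_euclidean w (\<chi> i. (\<Sum>k<n. z k $ i * y k) / sqrt 2)"
proof -
  have "hinner (finite_sequence_space n) (frame_analysis n z w) y
      = (\<Sum>k<n. \<Sum>j\<in>UNIV. w $ j * cnj (z k $ j) * cnj (y k) / sqrt 2)"
    by (simp add: frame_analysis_def sum_distrib_right sum_divide_distrib)
  also have "\<dots> = (\<Sum>j\<in>UNIV. \<Sum>k<n. w $ j * cnj (z k $ j) * cnj (y k) / sqrt 2)"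
    by (rule sum.swap)
  also have "\<dots> = hinner complex_euclidean w (\<chi> i. (\<Sum>k<n. z k $ i * y k) / sqrt 2)"
    by (simp add: sum_distrib_left sum_divide_distrib mult.assoc)
  finally show ?thesis .
qed

lemma adjoint_frame_analysis:
  "adjoint_operator complex_euclidean (finite_sequence_space n) (frame_analysis n z) y
    = (\<chi> i. (\<Sum>k<n. z k $ i * y k) / sqrt 2)"
  by (rule adjoint_operator_eqI[OF complex_hilbert_space_complex_euclidean])
     (simp_all only: hinner_frame_analysis complex_euclidean_simps UNIV_I)

lemma compression_diagonal_operator:
  "adjoint_operator complex_euclidean (finite_sequence_space n) (frame_analysis n z)
      (diagonal_operator F (frame_analysis n z w))
    = (\<chi> i j. (\<Sum>k<n. F k * (z k $ i * cnj (z k $ j))) / 2) *v w"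
proof -
  have s2: "complex_of_real (sqrt 2) * complex_of_real (sqrt 2) = 2"
    by (simp flip: of_real_mult)
  have "(\<Sum>k<n. z k $ i * (F k * ((\<Sum>j\<in>UNIV. w $ j * cnj (z k $ j)) / sqrt 2))) / sqrt 2
    = (\<Sum>j\<in>UNIV. (\<Sum>k<n. F k * (z k $ i * cnj (z k $ j))) / 2 * w $ j)" for i
  proof -
    have "(\<Sum>k<n. z k $ i * (F k * ((\<Sum>j\<in>UNIV. w $ j * cnj (z k $ j)) / sqrt 2))) / sqrt 2
      = (\<Sum>k<n. \<Sum>j\<in>UNIV. F k * (z k $ i * cnj (z k $ j)) / 2 * w $ j)"
      unfolding sum_divide_distrib[of _ _ "complex_of_real (sqrt 2)"]
      by (intro sum.cong refl) (simp add: sum_divide_distrib sum_distrib_left s2 mult_ac)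
    also have "\<dots> = (\<Sum>j\<in>UNIV. \<Sum>k<n. F k * (z k $ i * cnj (z k $ j)) / 2 * w $ j)"
      by (rule sum.swap)
    finally show ?thesis by (simp add: sum_divide_distrib sum_distrib_right)
  qed
  then show ?thesis
    by (simp add: adjoint_frame_analysis vec_eq_iff matrix_vector_mult_def diagonal_operator_def frame_analysis_def)
qed

text \<open>
  By \<open>compression_diagonal_operator\<close> for the constant diagonal \<open>1\<close>, the hypothesis says that \<open>V\<^sup>* V\<close>
  is the identity.
\<close>

lemma isometry_frame_analysis:
  assumes gram: "\<And>i j. (\<Sum>k<n. z k $ i * cnj (z k $ j)) = (if i = j then 2 else 0)"
  shows "isometry complex_euclidean (finite_sequence_space n) (frame_analysis n z)"
proof -
  let ?H = "finite_sequence_space n"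
  let ?V = "frame_analysis n z"
  have lin: "linear_operator complex_euclidean ?H ?V"
    by (auto simp: linear_operator_def frame_analysis_def fun_eq_iff sum.distrib add_divide_distrib
        distrib_right sum_distrib_left mult.assoc)
  have "hinner ?H (?V w) (?V w) = hinner complex_euclidean w w" for w
  proof -
    have ad: "adjoint_operator complex_euclidean ?H ?V (?V w) = w"
      using compression_diagonal_operator[of n z "\<lambda>_. 1" w]
      by (simp add: diagonal_operator_def gram matrix_vector_mult_def vec_eq_iff if_distrib if_distribR cong: if_cong)
    have "hinner ?H (?V w) (?V w) = hinner complex_euclidean w (adjoint_operator complex_euclidean ?H ?V (?V w))"
      by (simp only: adjoint_frame_analysis hinner_frame_analysis)
    then show ?thesis by (simp only: ad)
  qed
  then have "hnorm ?H (?V w) = hnorm complex_euclidean w" for w by (simp only: hnorm_def)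
  then show ?thesis using lin by (simp add: isometry_def)
qed

section \<open>Simultaneous dilation\<close>

theorem corollary1p9:
  shows "\<exists>(H :: (nat \<Rightarrow> complex) hilbert) (N :: ((nat \<Rightarrow> complex) \<Rightarrow> (nat \<Rightarrow> complex)) set)
            (V :: complex ^ 'd::finite \<Rightarrow> (nat \<Rightarrow> complex)).
    complex_hilbert_space H \<and>
    commuting_operators H N \<and>
    (\<forall>T\<in>N. normal_operator H T \<and> contraction H H T) \<and>
    isometry complex_euclidean H V \<and>
    (\<forall>X :: complex ^ 'd ^ 'd. onorm ((*v) X) \<le> 1 \<longrightarrow>
      (\<exists>T\<in>N. \<forall>v. ((1 / (sqrt 2 * vartheta TYPE('d + 'd))) *\<^sub>R X) *v v =
                  adjoint_operator complex_euclidean H V (T (V v))))"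
proof -
  define s :: real where "s = 19 / 20"
  have s01: "0 < s" "s < 1" by (simp_all add: s_def)
  define \<theta> where "\<theta> = vartheta TYPE('d + 'd)"
  obtain K :: "(real ^ ('d + 'd) + ('d + 'd)) set"
    and v :: "real ^ ('d + 'd) + ('d + 'd) \<Rightarrow> real ^ ('d + 'd)" where K: "finite K"
    and frame: "(\<Sum>k\<in>K. outer_square (v k)) = mat 1"
    and comp: "\<And>A. transpose A = A \<Longrightarrow> (\<And>x. \<bar>x \<bullet> (A *v x)\<bar> \<le> x \<bullet> x) \<Longrightarrow>
       \<exists>f. (\<forall>k. \<bar>f k\<bar> \<le> 1) \<and> (s / \<theta>) *\<^sub>R A = (\<Sum>k\<in>K. f k *\<^sub>R outer_square (v k))"
    unfolding \<theta>_def by (rule parseval_frame_compressions[OF s01, where 'm="'d + 'd"]) blast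
  define n where "n = card K"
  obtain g where g: "bij_betw g {..<n} K"
    using ex_bij_betw_nat_finite[OF K] by (auto simp: n_def atLeast0LessThan)
  define z where "z k = complexify (v (g k))" for k
  have sums: "(\<Sum>k<n. of_real (f (g k)) * (z k $ i * cnj (z k $ j))) = 2 * of_real c * A $ i $ j"
    if "(\<Sum>k\<in>K. f k *\<^sub>R outer_square (v k)) = c *\<^sub>R realify_matrix A" for f c A i j
    using sum_complexified_outer_squares[OF that, of i j]
      sum.reindex_bij_betw[OF g, of "\<lambda>k. of_real (f k) * (complexify (v k) $ i * cnj (complexify (v k) $ j))"]
    by (simp add: z_def)
  have gram: "(\<Sum>k<n. z k $ i * cnj (z k $ j)) = (if i = j then 2 else 0)" for i j
  proof -
    have "(\<Sum>k\<in>K. 1 *\<^sub>R outer_square (v k)) = 1 *\<^sub>R realify_matrix (mat 1)"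
      by (simp add: frame realify_matrix_mat_1)
    from sums[OF this, of i j] show ?thesis by (simp add: mat_def)
  qed
  define H where "H = finite_sequence_space n"
  define V where "V = frame_analysis n z"
  define N where "N = {diagonal_operator F | F. \<forall>k. norm (F k) \<le> 1}"
  have "\<exists>T\<in>N. \<forall>w. ((1 / (sqrt 2 * \<theta>)) *\<^sub>R X) *v w = adjoint_operator complex_euclidean H V (T (V w))"
    if X: "onorm ((*v) X) \<le> 1" for X :: "complex ^ 'd ^ 'd"
  proof -
    define \<omega> where "\<omega> = Complex (-1/2) (sqrt 3 / 2)"
    have "linear ((*v) X)"
      by (auto intro!: linearI simp: matrix_vector_right_distrib matrix_vector_mult_def vec_eq_iff scaleR_sum_right)
    then have "norm (X *v w) \<le> onorm ((*v) X) * norm w" for w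
      by (intro onorm) (simp add: linear_conv_bounded_linear)
    then have Xn: "norm (X *v w) \<le> norm w" for w
      using mult_right_mono[OF X norm_ge_zero[of w]] order_trans by fastforce
    have "norm \<omega> = 1" by (simp add: \<omega>_def cmod_def power_divide)
    have ex: "\<exists>f. (\<forall>k. \<bar>f k\<bar> \<le> 1) \<and> (\<forall>i j. (\<Sum>k<n. of_real (f k) * (z k $ i * cnj (z k $ j)))
          = 2 * of_real (s / \<theta>) * hermitian_part (\<chi> i j. e * X $ i $ j) $ i $ j)" if e: "norm e = 1" for e
    proof -
      let ?A = "hermitian_part (\<chi> i j. e * X $ i $ j)"
      obtain f where f: "\<forall>k. \<bar>f k\<bar> \<le> 1" "(s / \<theta>) *\<^sub>R realify_matrix ?A = (\<Sum>k\<in>K. f k *\<^sub>R outer_square (v k))"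
        using comp[OF transpose_realify_hermitian_part realify_hermitian_part_bound[OF Xn e]] by blast
      show ?thesis
        using f(1) sums[OF f(2)[symmetric]] by (intro exI[of _ "\<lambda>k. f (g k)"]) simp
    qed
    obtain f0 where f0: "\<forall>k. \<bar>f0 k\<bar> \<le> 1" "\<forall>i j. (\<Sum>k<n. of_real (f0 k) * (z k $ i * cnj (z k $ j)))
          = 2 * of_real (s / \<theta>) * hermitian_part (\<chi> i j. 1 * X $ i $ j) $ i $ j" using ex[of 1] by auto
    obtain f1 where f1: "\<forall>k. \<bar>f1 k\<bar> \<le> 1" "\<forall>i j. (\<Sum>k<n. of_real (f1 k) * (z k $ i * cnj (z k $ j)))
          = 2 * of_real (s / \<theta>) * hermitian_part (\<chi> i j. \<omega> * X $ i $ j) $ i $ j" using ex[of \<omega>] \<open>norm \<omega> = 1\<close> by auto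
    obtain f2 where f2: "\<forall>k. \<bar>f2 k\<bar> \<le> 1" "\<forall>i j. (\<Sum>k<n. of_real (f2 k) * (z k $ i * cnj (z k $ j)))
          = 2 * of_real (s / \<theta>) * hermitian_part (\<chi> i j. cnj \<omega> * X $ i $ j) $ i $ j" using ex[of "cnj \<omega>"] \<open>norm \<omega> = 1\<close> by auto
    \<comment> \<open>normalises the combination: the factors \<open>s/\<vartheta>\<close> of the frame and \<open>3/2\<close> of the cube roots leave \<open>1/(\<surd>2 \<vartheta>)\<close>\<close>
    define q where "q = sqrt 2 / (3 * s)"
    define F where "F k = of_real q * (of_real (f0 k) + cnj \<omega> * of_real (f1 k) + \<omega> * of_real (f2 k))" for k
    \<comment> \<open>this is \<open>2 q \<le> 1\<close>, where the gap between \<open>4/3\<close> and \<open>\<surd>2\<close> absorbs the factor \<open>s\<close>\<close>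
    have "sqrt 2 \<le> 57 / 40" by (rule real_le_lsqrt) (simp_all add: power2_eq_square)
    then have q: "0 \<le> q" "q * 2 \<le> 1" by (simp_all add: q_def s_def)
    have F1: "norm (F k) \<le> 1" for k
    proof -
      have "norm (F k) = q * norm (of_real (f0 k) + cnj \<omega> * of_real (f1 k) + \<omega> * of_real (f2 k))"
        using q by (simp add: F_def norm_mult)
      also have "\<dots> \<le> q * 2"
        using q f0(1) f1(1) f2(1) by (intro mult_left_mono cube_root_norm_bound) (auto simp: \<omega>_def)
      finally show ?thesis using q by simp
    qed
    have "(\<Sum>k<n. F k * (z k $ i * cnj (z k $ j))) / 2 = of_real (1 / (sqrt 2 * \<theta>)) * X $ i $ j" for i j
    proof -
      have "(\<Sum>k<n. F k * (z k $ i * cnj (z k $ j))) = of_real q * ((\<Sum>k<n. of_real (f0 k) * (z k $ i * cnj (z k $ j)))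
          + cnj \<omega> * (\<Sum>k<n. of_real (f1 k) * (z k $ i * cnj (z k $ j)))
          + \<omega> * (\<Sum>k<n. of_real (f2 k) * (z k $ i * cnj (z k $ j))))"
        by (simp add: F_def sum_distrib_left sum.distrib[symmetric] algebra_simps)
      also have "\<dots> = of_real (3 * (q * (s / \<theta>))) * (2 / 3 * (hermitian_part X $ i $ j
          + cnj \<omega> * hermitian_part (\<chi> i j. \<omega> * X $ i $ j) $ i $ j
          + \<omega> * hermitian_part (\<chi> i j. cnj \<omega> * X $ i $ j) $ i $ j))"
        unfolding f0(2)[rule_format] f1(2)[rule_format] f2(2)[rule_format] by (simp add: algebra_simps)
      also have "\<dots> = of_real (3 * (q * (s / \<theta>))) * X $ i $ j"
        by (simp only: cube_root_combination[OF \<omega>_def, symmetric])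
      also have "3 * (q * (s / \<theta>)) = 2 * (1 / (sqrt 2 * \<theta>))"
      proof -
        have "2 * (1 / (sqrt 2 * \<theta>)) = 2 / sqrt 2 / \<theta>" by simp
        also have "\<dots> = sqrt 2 / \<theta>" by (simp only: real_div_sqrt[of 2] zero_le_numeral)
        finally show ?thesis by (simp add: q_def s_def)
      qed
      finally show ?thesis by simp
    qed
    then have "(\<chi> i j. (\<Sum>k<n. F k * (z k $ i * cnj (z k $ j))) / 2) = (1 / (sqrt 2 * \<theta>)) *\<^sub>R X"
      by (simp add: vec_eq_iff) (simp add: scaleR_conv_of_real[where 'a=complex])
    then have "adjoint_operator complex_euclidean H V (diagonal_operator F (V w)) = ((1 / (sqrt 2 * \<theta>)) *\<^sub>R X) *v w" for w
      unfolding H_def V_def compression_diagonal_operator by simp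
    moreover have "diagonal_operator F \<in> N" using F1 by (auto simp: N_def)
    ultimately show ?thesis by (intro bexI[of _ "diagonal_operator F"]) auto
  qed
  moreover have "commuting_operators H N"
    by (auto simp: commuting_operators_def N_def diagonal_operator_def mult_ac)
  moreover have "\<forall>T\<in>N. normal_operator H T \<and> contraction H H T"
    by (auto simp: N_def H_def normal_diagonal_operator contraction_diagonal_operator)
  ultimately show ?thesis
    using complex_hilbert_space_finite_sequence_space[of n] isometry_frame_analysis[OF gram]
    unfolding \<theta>_def H_def[symmetric] V_def[symmetric] by blast
qed

end
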